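(* Let $d,m\in\mathbb{N}$, let $\sigma_{ij}\ge 0$ for $i\in[d]$, $j\in[m]$, and let $$x=\sum_{i=1}^d\sum_{j=1}^m\sigma_{ij}\,e_ie_j^*\otimes s_{ij},$$ where $(s_{ij})_{i\in[d],j\in[m]}$ is a free semicircular family and $e_1,e_2,\ldots$ denote the standard basis vectors in $\mathbb{C}^d$ or $\mathbb{C}^m$ (so $e_ie_j^*\in\mathbb{C}^{d\times m}$). Let $b\in\mathbb{C}^{d\times d}$ be the diagonal matrix with real diagonal entries $b_1,\ldots,b_d$. Then $$\lambda_{\rm max}(xx^*+b\otimes\mathbf{1})=\inf_{\substack{\min_j v_j>0\\ \max_j\sum_k\sigma_{kj}^2v_k<1}}\max_{i\in[d]}\Bigg(b_i+\frac{1}{v_i}+\sum_{j\in[m]}\frac{\sigma_{ij}^2}{1-\sum_{k\in[d]}\sigma_{kj}^2v_k}\Bigg)$$ and $$\lambda_{\rm min}(xx^*+b\otimes\mathbf{1})=\sup_{\max_j v_j<0}\,\min_{i\in[d]}\Bigg(b_i+\frac{1}{v_i}+\sum_{j\in[m]}\frac{\sigma_{ij}^2}{1-\sum_{k\in[d]}\sigma_{kj}^2v_k}\Bigg),$$ where $v$ ranges over $\mathbb{R}^d$. Moreover, the infimum (respectively supremum) can be restricted to those $v$ satisfying the indicated constraints for which the vector (indexed by $i\in[d]$) inside the maximum (respectively minimum) is a multiple of the constant vector $1$, without changing its value.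
   Context: $[d]=\{1,\ldots,d\}$; $\mathbf{1}$ is the identity. For self-adjoint $y$ with spectrum $\mathrm{sp}(y)$, $\lambda_{\rm max}(y)=\sup\mathrm{sp}(y)$ and $\lambda_{\rm min}(y)=\inf\mathrm{sp}(y)$. A free semicircular family is a family of freely independent self-adjoint elements of a $C^*$-probability space $(\mathcal{S},\tau)$ with faithful trace $\tau$, each having the standard semicircular distribution (density $\frac{1}{2\pi}\sqrt{4-t^2}$ on $[-2,2]$). The element $x\in\mathbb{C}^{d\times m}\otimes\mathcal{S}$ is regarded as a $d\times m$ matrix with entries in $\mathcal{S}$, so that $xx^*\in\mathbb{C}^{d\times d}\otimes\mathcal{S}$. *)

theory Defs
  imports "HOL-Analysis.Analysis"
begin

section \<open>C*-probability spaces\<close>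

text \<open>Unital complex C*-algebras. The superclass \<^class>\<open>real_normed_algebra_1\<close> includes
  \<open>norm 1 = 1\<close>, which excludes only the zero algebra (on which there is no state).\<close>

class cstar_algebra = real_normed_algebra_1 + banach +
  fixes scaleC :: "complex \<Rightarrow> 'a \<Rightarrow> 'a"
    and star :: "'a \<Rightarrow> 'a"
  assumes scaleC_add_right: "scaleC c (a + b) = scaleC c a + scaleC c b"
    and scaleC_add_left: "scaleC (c + d) a = scaleC c a + scaleC d a"
    and scaleC_scaleC: "scaleC c (scaleC d a) = scaleC (c * d) a"
    and scaleC_of_real: "scaleC (complex_of_real r) a = scaleR r a"
    and scaleC_mult_left: "scaleC c a * b = scaleC c (a * b)"
    and scaleC_mult_right: "a * scaleC c b = scaleC c (a * b)"
    and norm_scaleC: "norm (scaleC c a) = cmod c * norm a"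
    and star_add: "star (a + b) = star a + star b"
    and star_scaleC: "star (scaleC c a) = scaleC (cnj c) (star a)"
    and star_mult: "star (a * b) = star b * star a"
    and star_star: "star (star a) = a"
    and cstar_identity: "norm (star a * a) = (norm a)\<^sup>2"

locale cstar_prob_space =
  fixes \<tau> :: "'a::cstar_algebra \<Rightarrow> complex"
  assumes state_add: "\<tau> (a + b) = \<tau> a + \<tau> b"
    and state_scaleC: "\<tau> (scaleC c a) = c * \<tau> a"
    and state_one: "\<tau> 1 = 1"
    and state_positive: "\<tau> (star a * a) \<in> \<real>\<^sub>\<ge>\<^sub>0"

locale faithful_trace_cstar_prob_space = cstar_prob_space +
  assumes tracial: "\<tau> (a * b) = \<tau> (b * a)"
    and faithful: "\<tau> (star a * a) = 0 \<Longrightarrow> a = 0"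

inductive_set generated_star_algebra :: "'a::cstar_algebra set \<Rightarrow> 'a set" for X where
  base: "a \<in> X \<Longrightarrow> a \<in> generated_star_algebra X"
| one: "1 \<in> generated_star_algebra X"
| add: "a \<in> generated_star_algebra X \<Longrightarrow> b \<in> generated_star_algebra X
    \<Longrightarrow> a + b \<in> generated_star_algebra X"
| scaleC: "a \<in> generated_star_algebra X \<Longrightarrow> scaleC c a \<in> generated_star_algebra X"
| mult: "a \<in> generated_star_algebra X \<Longrightarrow> b \<in> generated_star_algebra X
    \<Longrightarrow> a * b \<in> generated_star_algebra X"
| star: "a \<in> generated_star_algebra X \<Longrightarrow> star a \<in> generated_star_algebra X"

text \<open>Free independence: \<open>\<tau> (c\<^sub>1 \<cdots> c\<^sub>n) = 0\<close> for \<open>n \<ge> 1\<close> whenever every \<open>c\<^sub>l\<close> is centred and lies in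
  the unital *-algebra generated by \<open>a k\<^sub>l\<close>, and neighbouring indices \<open>k\<^sub>l\<close>, \<open>k\<^sub>l\<^sub>+\<^sub>1\<close> are distinct.\<close>

definition freely_independent ::
    "('a::cstar_algebra \<Rightarrow> complex) \<Rightarrow> ('i \<Rightarrow> 'a) \<Rightarrow> bool" where
  "freely_independent \<tau> a \<longleftrightarrow>
    (\<forall>ks cs. ks \<noteq> [] \<longrightarrow> distinct_adj ks \<longrightarrow>
      list_all2 (\<lambda>k c. c \<in> generated_star_algebra {a k} \<and> \<tau> c = 0) ks cs \<longrightarrow>
      \<tau> (prod_list cs) = 0)"

definition semicircle_distribution :: "real measure" where
  "semicircle_distribution =
    density lborel (\<lambda>t. ennreal (indicator {-2..2} t * (1 / (2 * pi) * sqrt (4 - t\<^sup>2))))"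

text \<open>The law of a self-adjoint element is the compactly supported measure on the line
  with the same moments.\<close>

definition standard_semicircular :: "('a::cstar_algebra \<Rightarrow> complex) \<Rightarrow> 'a \<Rightarrow> bool" where
  "standard_semicircular \<tau> a \<longleftrightarrow> star a = a \<and>
    (\<forall>k::nat. \<tau> (a ^ k) = complex_of_real (LINT t|semicircle_distribution. t ^ k))"

definition free_semicircular_family ::
    "('a::cstar_algebra \<Rightarrow> complex) \<Rightarrow> ('i \<Rightarrow> 'a) \<Rightarrow> bool" where
  "free_semicircular_family \<tau> s \<longleftrightarrow>
    freely_independent \<tau> s \<and> (\<forall>k. standard_semicircular \<tau> (s k))"


section \<open>Matrices over a C*-algebra\<close>

text \<open>The tensor product of the \<open>d \<times> m\<close> complex matrices with \<open>\<S>\<close> is the space of \<open>d \<times> m\<close>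
  matrices with entries in \<open>\<S>\<close>.\<close>

definition tensor :: "complex^'m^'d \<Rightarrow> 'a::cstar_algebra \<Rightarrow> 'a^'m^'d" where
  "tensor A a = (\<chi> i j. scaleC (A $ i $ j) a)"

definition mstar :: "'a::cstar_algebra^'m^'d \<Rightarrow> 'a^'d^'m" where
  "mstar A = (\<chi> i j. star (A $ j $ i))"

text \<open>The rank-one matrix \<open>u w\<^sup>*\<close>.\<close>

definition outer :: "complex^'d \<Rightarrow> complex^'m \<Rightarrow> complex^'m^'d" where
  "outer u w = (\<chi> k l. u $ k * cnj (w $ l))"

definition diagonal :: "real^'d \<Rightarrow> complex^'d^'d" where
  "diagonal b = (\<chi> i j. if i = j then complex_of_real (b $ i) else 0)"

definition matrix_spectrum :: "'a::cstar_algebra^'d^'d \<Rightarrow> complex set" where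
  "matrix_spectrum y = {z. \<not> invertible (y - mat (scaleC z 1))}"

text \<open>Meant for self-adjoint \<open>y\<close>, whose spectrum is a nonempty compact set of real numbers.\<close>

definition lambda_max :: "'a::cstar_algebra^'d^'d \<Rightarrow> real" where
  "lambda_max y = Sup (Re ` matrix_spectrum y)"

definition lambda_min :: "'a::cstar_algebra^'d^'d \<Rightarrow> real" where
  "lambda_min y = Inf (Re ` matrix_spectrum y)"


section \<open>The variational problem\<close>

text \<open>Infima and suprema of \<open>objective\<close> over the sets below are meant to be taken in \<^typ>\<open>ereal\<close>:
  in \<^typ>\<open>real\<close> they would be unspecified for empty sets and unbounded functions.\<close>

definition objective :: "real^'m^'d \<Rightarrow> real^'d \<Rightarrow> real^'d \<Rightarrow> real^'d" where
  "objective \<sigma> b v = (\<chi> i. b $ i + 1 / v $ i +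
    (\<Sum>j\<in>UNIV. (\<sigma> $ i $ j)\<^sup>2 / (1 - (\<Sum>k\<in>UNIV. (\<sigma> $ k $ j)\<^sup>2 * v $ k))))"

definition feasible_max :: "real^'m^'d \<Rightarrow> (real^'d) set" where
  "feasible_max \<sigma> =
    {v. (MIN j. v $ j) > 0 \<and> (MAX j. \<Sum>k\<in>UNIV. (\<sigma> $ k $ j)\<^sup>2 * v $ k) < 1}"

definition feasible_min :: "(real^'d) set" where
  "feasible_min = {v. (MAX j. v $ j) < 0}"

text \<open>Those \<open>v\<close> for which \<open>objective \<sigma> b v\<close> is a multiple of the constant vector 1.\<close>

definition equalizing :: "real^'m^'d \<Rightarrow> real^'d \<Rightarrow> (real^'d) set" where
  "equalizing \<sigma> b = {v. \<exists>c::real. objective \<sigma> b v = c *\<^sub>R 1}"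

end

theory Submission
  imports Defs
begin

text \<open>On the full Fock space the semicircular elements are modelled by \<open>l + l\<^sup>*\<close> with the creation
  operators \<open>l\<close>. By freeness, products of Chebyshev polynomials embed the algebraic Fock space
  isometrically into \<open>L\<^sup>2(\<S>, \<tau>)\<close>, so \<open>y = x x\<^sup>* + b\<close> has the same moments as its model \<open>Y\<close> on the Fock
  space; since the trace is faithful, the extreme points of the spectrum of \<open>y\<close> are the optimal
  bounds of the quadratic form of \<open>Y\<close>. A feasible \<open>v\<close> bounds this form by completing squares and
  using \<open>l\<^sub>i\<^sup>* l\<^sub>j = \<delta>\<^sub>i\<^sub>j\<close>. Conversely, for \<open>z\<close> outside these bounds the vacuum expectations \<open>v\<^sub>i\<close> of the
  diagonal entries of \<open>(z - Y)\<^sup>-\<^sup>1\<close> satisfy the Dyson equation, which says that all entries of the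
  objective at \<open>v\<close> equal \<open>z\<close>. The Dyson equation comes from commuting the resolvent with right
  creation operators, whose commutators with left multiplication have finite rank.\<close>

section \<open>Square roots in C*-algebras\<close>

text \<open>The spectrum is taken in an abstract C*-algebra, whereas everything computable lives on
  an incomplete real inner product space; this gap shapes the proof. The moments see only the
  algebra generated by the \<open>s i j\<close>, while an inverse of \<open>Y - z\<close> may have
  entries anywhere in the C*-algebra. Hence there are two separate passages. Operator bounds on the
  Fock space make Neumann series summable entry by entry in the C*-norm, which keeps distant points
  out of the spectrum. Conversely an inverse, wherever its entries lie, is bounded in L2 of the
  trace and forces the shifted model to be bounded below. In both passages square roots obtained by
  a scalar-dominated iteration replace functional calculus. Real scalars suffice on the Fock space
  because \<open>\<sigma>\<close> and \<open>b\<close> are real. There the resolvent exists only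
  through its matrix coefficients, so operator identities are proved for partial Neumann sums and
  passed to the limit. The two variational formulas share this argument; what changes is the
  endpoint about which the model is rescaled.\<close>

lemma star_zero [simp]: "star 0 = 0"
  using star_add[of 0 0] by simp

lemma star_minus: "star (- a) = - star a"
  using star_add[of a "- a"] by (simp add: eq_neg_iff_add_eq_0 add.commute)

lemma star_diff: "star (a - b) = star a - star b"
  using star_add[of a "- b"] by (simp add: star_minus)

lemma star_one [simp]: "star 1 = 1"
  by (metis mult_1_left mult_1_right star_mult star_star)

lemma star_scaleR: "star (r *\<^sub>R a) = r *\<^sub>R star a"
  using star_scaleC[of "complex_of_real r" a] by (simp add: scaleC_of_real)

lemma star_sum: "star (sum f A) = (\<Sum>i\<in>A. star (f i))"
  by (induction A rule: infinite_finite_induct) (simp_all add: star_add)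

lemma star_power: "star (a ^ n) = star a ^ n"
  by (induction n) (simp_all add: star_mult power_commutes)

lemma norm_star [simp]: "norm (star a) = norm a"
proof -
  have le: "norm b \<le> norm (star b)" for b
  proof (cases "norm b = 0")
    case False
    have "norm b * norm b \<le> norm (star b) * norm b"
      using norm_mult_ineq[of "star b" b] by (simp add: cstar_identity) (simp add: power2_eq_square)
    then show ?thesis using False by (simp add: mult_le_cancel_right)
  qed simp
  show ?thesis using le[of a] le[of "star a"] by (simp add: star_star)
qed

lemma scaleC_zero_right [simp]: "scaleC c 0 = 0"
  using scaleC_add_right[of c 0 0] by simp

lemma scaleC_zero_left [simp]: "scaleC 0 a = 0"
  using scaleC_add_left[of 0 0 a] by simp

lemma scaleC_one [simp]: "scaleC 1 a = a"
  using scaleC_of_real[of 1 a] by simp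

lemma scaleC_minus_left: "scaleC (- c) a = - scaleC c a"
  using scaleC_add_left[of c "- c" a] by (simp add: eq_neg_iff_add_eq_0 add.commute)

lemma scaleC_minus_right: "scaleC c (- a) = - scaleC c a"
  using scaleC_add_right[of c a "- a"] by (simp add: eq_neg_iff_add_eq_0 add.commute)

lemma scaleC_diff_right: "scaleC c (a - b) = scaleC c a - scaleC c b"
  using scaleC_add_right[of c a "- b"] by (simp add: scaleC_minus_right)

lemma scaleC_diff_left: "scaleC (c - d) a = scaleC c a - scaleC d a"
  using scaleC_add_left[of c "- d" a] by (simp add: scaleC_minus_left)

lemma scaleC_sum_right: "scaleC c (sum f A) = (\<Sum>i\<in>A. scaleC c (f i))"
  by (induction A rule: infinite_finite_induct) (simp_all add: scaleC_add_right)

lemma tendsto_star: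
  fixes f :: "'b \<Rightarrow> 'a::cstar_algebra"
  assumes "(f \<longlongrightarrow> l) F"
  shows "((\<lambda>x. star (f x)) \<longlongrightarrow> star l) F"
proof -
  have "((\<lambda>x. norm (f x - l)) \<longlongrightarrow> 0) F"
    using assms by (simp add: tendsto_norm_zero_iff LIM_zero_iff)
  then have "((\<lambda>x. norm (star (f x) - star l)) \<longlongrightarrow> 0) F"
    by (simp flip: star_diff)
  then show ?thesis by (simp add: tendsto_norm_zero_iff LIM_zero_iff)
qed

text \<open>The iteration \<open>y \<mapsto> (x + y\<^sup>2) / 2\<close> converges to \<open>1 - \<surd>(1 - x)\<close>: its increments are dominated
  by those of the scalar iteration with \<open>x = 1\<close>, since they are polynomials in \<open>x\<close> with
  nonnegative coefficients.\<close>

primrec sqrt_iter :: "'a::real_normed_algebra_1 \<Rightarrow> nat \<Rightarrow> 'a" where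
  "sqrt_iter x 0 = 0"
| "sqrt_iter x (Suc n) = (1 / 2) *\<^sub>R (x + sqrt_iter x n * sqrt_iter x n)"

lemma sqrt_iter_commute:
  assumes "c * x = x * c"
  shows "c * sqrt_iter x n = sqrt_iter x n * c"
proof (induction n)
  case (Suc n)
  have "c * (sqrt_iter x n * sqrt_iter x n) = sqrt_iter x n * sqrt_iter x n * c"
    by (metis Suc mult.assoc)
  then show ?case using assms by (simp add: algebra_simps)
qed simp

lemma sqrt_iter_one_bounds: "0 \<le> sqrt_iter (1::real) n \<and> sqrt_iter (1::real) n \<le> 1"
proof (induction n)
  case (Suc n)
  then have "sqrt_iter (1::real) n * sqrt_iter 1 n \<le> 1" by (simp add: mult_le_one)
  with Suc show ?case by simp
qed simp

lemma sqrt_iter_one_mono: "sqrt_iter (1::real) n \<le> sqrt_iter 1 (Suc n)"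
proof -
  have "0 \<le> (1 - sqrt_iter (1::real) n) ^ 2" by simp
  then show ?thesis by (simp add: power2_eq_square algebra_simps)
qed

lemma norm_sqrt_iter_le:
  assumes "norm x \<le> 1"
  shows "norm (sqrt_iter x n) \<le> sqrt_iter 1 n"
proof (induction n)
  case (Suc n)
  have "norm (sqrt_iter x n * sqrt_iter x n) \<le> sqrt_iter 1 n * sqrt_iter 1 n"
    by (rule order_trans[OF norm_mult_ineq mult_mono[OF Suc Suc]])
      (auto simp: sqrt_iter_one_bounds)
  then show ?case using assms norm_triangle_ineq[of x "sqrt_iter x n * sqrt_iter x n"] by simp
qed simp

lemma norm_sqrt_iter_diff_le:
  assumes "norm x \<le> 1"
  shows "norm (sqrt_iter x (Suc n) - sqrt_iter x n) \<le> sqrt_iter 1 (Suc n) - sqrt_iter 1 n"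
proof (induction n)
  case 0
  then show ?case using assms by simp
next
  case (Suc n)
  let ?a = "sqrt_iter x (Suc n)" and ?b = "sqrt_iter x n"
  let ?s = "sqrt_iter (1::real) (Suc n)" and ?t = "sqrt_iter (1::real) n"
  have comm: "?a * ?b = ?b * ?a"
    by (metis sqrt_iter_commute)
  have "sqrt_iter x (Suc (Suc n)) - ?a = (1 / 2) *\<^sub>R (?a * ?a - ?b * ?b)"
    using sqrt_iter.simps(2)[of x "Suc n"] sqrt_iter.simps(2)[of x n]
    by (simp only: scaleR_diff_right scaleR_add_right) simp
  also have "?a * ?a - ?b * ?b = (?a - ?b) * (?a + ?b)"
    using comm by (simp only: algebra_simps)
  finally have eq: "sqrt_iter x (Suc (Suc n)) - ?a = (1 / 2) *\<^sub>R ((?a - ?b) * (?a + ?b))" .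
  have "norm (?a + ?b) \<le> ?s + ?t"
    using norm_triangle_ineq[of ?a ?b] norm_sqrt_iter_le[OF assms, of n]
      norm_sqrt_iter_le[OF assms, of "Suc n"] by linarith
  then have "norm ((?a - ?b) * (?a + ?b)) \<le> (?s - ?t) * (?s + ?t)"
    using Suc sqrt_iter_one_mono[of n]
    by (intro order_trans[OF norm_mult_ineq mult_mono]) auto
  then have "norm (sqrt_iter x (Suc (Suc n)) - ?a) \<le> 1 / 2 * ((?s - ?t) * (?s + ?t))"
    unfolding eq norm_scaleR by simp
  also have "\<dots> = sqrt_iter 1 (Suc (Suc n)) - ?s"
    using sqrt_iter.simps(2)[of "1::real" "Suc n"] sqrt_iter.simps(2)[of "1::real" n]
    by (simp only: real_scaleR_def) (simp add: field_simps)
  finally show ?case .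
qed

text \<open>Stands in for the continuous functional calculus: \<open>y\<close> is a limit of real
  polynomials in \<open>x\<close>, hence inherits self-adjointness and commutes with whatever
  commutes with \<open>x\<close>. The bound \<open>norm y \<le> 1\<close> allows the construction to
  be iterated.\<close>

lemma sqrt_one_minus:
  fixes x :: "'a::cstar_algebra"
  assumes x: "norm x \<le> 1"
  obtains y where "norm y \<le> 1" "(1 - y) * (1 - y) = 1 - x" "star x = x \<Longrightarrow> star y = y"
    "\<And>c. c * x = x * c \<Longrightarrow> c * y = y * c"
proof -
  have "incseq (sqrt_iter (1::real))"
    by (intro incseq_SucI sqrt_iter_one_mono)
  then have "convergent (sqrt_iter (1::real))"
    using incseq_convergent[of "sqrt_iter (1::real)" 1] sqrt_iter_one_bounds convergentI by metis
  then have "summable (\<lambda>n. sqrt_iter (1::real) (Suc n) - sqrt_iter 1 n)"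
    unfolding convergent_def using telescope_summable by blast
  then have "summable (\<lambda>n. sqrt_iter x (Suc n) - sqrt_iter x n)"
    by (rule summable_comparison_test'[where N = 0]) (rule norm_sqrt_iter_diff_le[OF x])
  then have "(\<lambda>n. \<Sum>k<n. sqrt_iter x (Suc k) - sqrt_iter x k)
      \<longlonglongrightarrow> (\<Sum>n. sqrt_iter x (Suc n) - sqrt_iter x n)"
    by (rule summable_LIMSEQ)
  then obtain y where y: "sqrt_iter x \<longlonglongrightarrow> y"
    unfolding sum_lessThan_telescope sqrt_iter.simps(1) diff_zero by (rule that)
  show thesis
  proof
    show "norm y \<le> 1"
    proof (rule LIMSEQ_le_const2[OF tendsto_norm[OF y]])
      show "\<exists>N. \<forall>n\<ge>N. norm (sqrt_iter x n) \<le> 1"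
        using norm_sqrt_iter_le[OF x] sqrt_iter_one_bounds by (meson order_trans)
    qed
    have "(\<lambda>n. (1 / 2) *\<^sub>R (x + sqrt_iter x n * sqrt_iter x n)) \<longlonglongrightarrow> (1 / 2) *\<^sub>R (x + y * y)"
      by (intro tendsto_intros y)
    then have "(\<lambda>n. sqrt_iter x (Suc n)) \<longlonglongrightarrow> (1 / 2) *\<^sub>R (x + y * y)"
      by simp
    then have "y = (1 / 2) *\<^sub>R (x + y * y)"
      using LIMSEQ_Suc[OF y] LIMSEQ_unique by blast
    then have "2 *\<^sub>R y = 2 *\<^sub>R ((1 / 2) *\<^sub>R (x + y * y))"
      by (rule arg_cong)
    then have "2 *\<^sub>R y = x + y * y" by simp
    then show "(1 - y) * (1 - y) = 1 - x"
      by (simp add: algebra_simps scaleR_2)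
    show "star y = y" if "star x = x"
    proof -
      have "star (sqrt_iter x n) = sqrt_iter x n" for n
        by (induction n) (simp_all add: star_scaleR star_add star_mult that)
      then have "(\<lambda>n. star (sqrt_iter x n)) \<longlonglongrightarrow> y" using y by simp
      with tendsto_star[OF y] show ?thesis by (rule LIMSEQ_unique)
    qed
    show "c * y = y * c" if "c * x = x * c" for c
    proof -
      have l: "(\<lambda>n. c * sqrt_iter x n) \<longlonglongrightarrow> c * y" by (rule tendsto_mult_left[OF y])
      have "(\<lambda>n. sqrt_iter x n * c) \<longlonglongrightarrow> y * c" by (rule tendsto_mult_right[OF y])
      then have "(\<lambda>n. c * sqrt_iter x n) \<longlonglongrightarrow> y * c" by (simp only: sqrt_iter_commute[OF that])
      with l show ?thesis by (rule LIMSEQ_unique)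
    qed
  qed
qed

text \<open>The element \<open>a + scaleC \<i> s\<close> has norm \<open>K\<close> by the
  C*-identity, and \<open>a\<close> is its real part.\<close>

lemma norm_le_of_sum_squares:
  fixes a s :: "'a::cstar_algebra"
  assumes sa: "star a = a" "star s = s" "a * s = s * a"
    and eq: "a * a + s * s = (K\<^sup>2) *\<^sub>R 1" and K: "0 \<le> K"
  shows "norm a \<le> K"
proof -
  define u where "u = a + scaleC \<i> s"
  have su: "star u = a - scaleC \<i> s"
    unfolding u_def by (simp add: star_add star_scaleC sa scaleC_minus_left)
  have "star u * u = a * a + s * s"
    unfolding su unfolding u_def
    by (simp add: algebra_simps scaleC_mult_left scaleC_mult_right scaleC_scaleC sa
        scaleC_minus_left scaleC_diff_right)
  then have "(norm u)\<^sup>2 = K\<^sup>2"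
    unfolding cstar_identity[symmetric] eq by simp
  then have nu: "norm u = K" using K by simp
  have "2 *\<^sub>R a = u + star u" unfolding su unfolding u_def by (simp add: scaleR_2)
  then have "2 * norm a \<le> norm u + norm (star u)"
    by (metis norm_triangle_ineq norm_scaleR abs_numeral)
  then show ?thesis using nu by simp
qed

text \<open>The triangle inequality gives only 2. The square root \<open>1 - y\<close> of
  \<open>1 - a * a\<close> commutes with \<open>a\<close>, and the squares of the two add up to 1,
  so \<open>1 - y\<close> is a contraction. The bound 1 is what allows \<open>sqrt_one_minus\<close>
  to be applied to \<open>1 - q * q\<close> in turn.\<close>

lemma norm_one_minus_square_le:
  fixes a :: "'a::cstar_algebra"
  assumes "norm a \<le> 1" "star a = a"
  shows "norm (1 - a * a) \<le> 1"
proof -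
  have "norm (a * a) \<le> 1"
    using norm_mult_ineq[of a a] assms(1) mult_le_one[of "norm a" "norm a"] by simp
  from sqrt_one_minus[OF this] obtain y where y: "(1 - y) * (1 - y) = 1 - a * a"
    "star (a * a) = a * a \<Longrightarrow> star y = y" "\<And>c. c * (a * a) = a * a * c \<Longrightarrow> c * y = y * c"
    by blast
  have sy: "star y = y" using y(2) assms(2) by (simp add: star_mult)
  have cy: "a * y = y * a" using y(3)[of a] by (simp add: mult.assoc)
  have "norm (1 - y) \<le> 1"
    by (rule norm_le_of_sum_squares[where s = a])
      (use sy cy y(1) assms in \<open>auto simp: star_diff algebra_simps\<close>)
  then have "norm ((1 - y) * (1 - y)) \<le> 1"
    using norm_mult_ineq[of "1 - y" "1 - y"] mult_le_one[of "norm (1 - y)" "norm (1 - y)"] by simp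
  then show ?thesis using y(1) by simp
qed

text \<open>The element \<open>w\<^sup>2\<close> is \<open>\<bar>q\<bar>\<close>, hence \<open>w\<close> is its square root.\<close>

lemma sqrt_abs:
  fixes q :: "'a::cstar_algebra"
  assumes "norm q \<le> 1" "star q = q"
  obtains w where "star w = w" "(w * w) * (w * w) = q * q" "\<And>c. c * q = q * c \<Longrightarrow> c * w = w * c"
proof -
  \<comment> \<open>Since \<open>q * q = 1 - (1 - q * q)\<close>, the root \<open>1 - y\<close> is
    the absolute value of \<open>q\<close>; the bound on \<open>y\<close> admits a second
    root.\<close>
  obtain y where y: "norm y \<le> 1" "(1 - y) * (1 - y) = 1 - (1 - q * q)"
    "star (1 - q * q) = 1 - q * q \<Longrightarrow> star y = y"
    "\<And>c. c * (1 - q * q) = (1 - q * q) * c \<Longrightarrow> c * y = y * c"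
    using sqrt_one_minus[OF norm_one_minus_square_le[OF assms]] by blast
  have sy: "star y = y" using y(3) by (simp add: star_diff star_mult assms)
  obtain z where z: "(1 - z) * (1 - z) = 1 - y" "star y = y \<Longrightarrow> star z = z"
    "\<And>c. c * y = y * c \<Longrightarrow> c * z = z * c"
    using sqrt_one_minus[OF y(1)] by blast
  show thesis
  proof
    show "star (1 - z) = 1 - z" using z(2) sy by (simp add: star_diff)
    show "(1 - z) * (1 - z) * ((1 - z) * (1 - z)) = q * q" using z(1) y(2) by simp
    show "c * (1 - z) = (1 - z) * c" if "c * q = q * c" for c
    proof -
      have "c * (q * q) = q * q * c" by (metis that mult.assoc)
      then have "c * y = y * c" using y(4) by (simp add: algebra_simps)
      then show ?thesis using z(3) by (simp add: algebra_simps)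
    qed
  qed
qed

lemma self_adjoint_square_eq_zero:
  fixes a :: "'a::cstar_algebra"
  assumes "star a = a" "a * a = 0"
  shows "a = 0"
  using cstar_identity[of a] assms by simp


section \<open>States and faithful traces\<close>

context cstar_prob_space
begin

lemma state_zero [simp]: "\<tau> 0 = 0"
  using state_scaleC[of 0 0] by simp

lemma state_minus: "\<tau> (- a) = - \<tau> a"
  using state_add[of a "- a"] by (simp add: eq_neg_iff_add_eq_0 add.commute)

lemma state_diff: "\<tau> (a - b) = \<tau> a - \<tau> b"
  using state_add[of a "- b"] by (simp add: state_minus)

lemma state_scaleR: "\<tau> (r *\<^sub>R a) = r *\<^sub>R \<tau> a"
  using state_scaleC[of "complex_of_real r" a] by (simp add: scaleC_of_real scaleR_conv_of_real)

lemma state_sum: "\<tau> (sum f A) = (\<Sum>i\<in>A. \<tau> (f i))"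
  by (induction A rule: infinite_finite_induct) (simp_all add: state_add)

lemma state_nonneg: "0 \<le> Re (\<tau> (star a * a))"
  using state_positive[of a] by (simp add: complex_nonneg_Reals_iff)

text \<open>With \<open>c\<close> the normalised \<open>a\<close>, the square root
  \<open>1 - y\<close> of \<open>1 - star c * c\<close> writes the gap between the two sides as a
  positive multiple of the state at \<open>star ((1 - y) * b) * ((1 - y) * b)\<close>. Elements of
  the algebra thus act boundedly on L2 of the state.\<close>

lemma state_mult_le:
  "Re (\<tau> (star (a * b) * (a * b))) \<le> (norm a)\<^sup>2 * Re (\<tau> (star b * b))"
proof (cases "a = 0")
  case False
  define c where "c = (1 / norm a) *\<^sub>R a"
  have nc: "norm (star c * c) = 1" using False unfolding cstar_identity by (simp add: c_def)
  obtain y where y: "(1 - y) * (1 - y) = 1 - star c * c"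
    "star (star c * c) = star c * c \<Longrightarrow> star y = y"
    using sqrt_one_minus[of "star c * c"] nc by auto
  have sy: "star y = y" using y(2) by (simp add: star_mult star_star)
  have "star ((1 - y) * b) * ((1 - y) * b) = star b * ((1 - y) * (1 - y)) * b"
    by (simp add: star_mult star_diff sy mult.assoc)
  also have "\<dots> = star b * b - star (c * b) * (c * b)"
    unfolding y(1) by (simp add: star_mult algebra_simps)
  finally have "0 \<le> Re (\<tau> (star b * b)) - Re (\<tau> (star (c * b) * (c * b)))"
    using state_nonneg[of "(1 - y) * b"] by (simp add: state_diff)
  moreover have "star (a * b) * (a * b) = (norm a)\<^sup>2 *\<^sub>R (star (c * b) * (c * b))"
    using False by (simp add: c_def star_scaleR star_mult power2_eq_square)
  ultimately show ?thesis
    by (simp add: state_scaleR mult_left_mono)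
qed simp

text \<open>Cauchy-Schwarz for \<open>p ^ k * x\<close> and \<open>p ^ (k + 2) * x\<close>: the even
  moments are log-convex.\<close>

lemma state_Cauchy_Schwarz_powers:
  fixes p x :: 'a
  assumes "star p = p"
  defines "c \<equiv> \<lambda>k. Re (\<tau> (star x * p ^ (2 * k) * x))"
  shows "(c (Suc k))\<^sup>2 \<le> c k * c (Suc (Suc k))"
proof -
  have c: "c (k + n) = Re (\<tau> (star (p ^ k * x) * (p ^ (2 * n) * (p ^ k * x))))" for n
  proof -
    have "p ^ (2 * (k + n)) = p ^ k * p ^ (2 * n) * p ^ k" by (simp add: mult_2 add_ac flip: power_add)
    then show ?thesis unfolding c_def by (simp add: star_mult star_power assms(1) mult.assoc)
  qed
  define u where "u = p ^ k * x"
  have "c k - 2 * r * c (Suc k) + r\<^sup>2 * c (Suc (Suc k)) \<ge> 0" for r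
  proof -
    have "star (u - r *\<^sub>R (p ^ 2 * u)) * (u - r *\<^sub>R (p ^ 2 * u)) =
        star u * u - (2 * r) *\<^sub>R (star u * (p ^ 2 * u)) + r\<^sup>2 *\<^sub>R (star u * (p ^ 4 * u))"
    proof -
      have "p ^ 4 = p ^ 2 * p ^ 2" by (simp flip: power_add)
      moreover have "(2 * r) *\<^sub>R a = r *\<^sub>R a + r *\<^sub>R a" for a :: 'a
        by (metis mult_2 scaleR_left.add)
      ultimately show ?thesis
        by (simp add: star_diff star_scaleR star_mult star_power assms(1)
            power2_eq_square[of r] algebra_simps)
    qed
    from arg_cong[OF this, of "\<lambda>a. Re (\<tau> a)"] state_nonneg[of "u - r *\<^sub>R (p ^ 2 * u)"]
    show ?thesis using c[of 0] c[of 1] c[of 2]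
      by (simp add: state_diff state_add state_scaleR u_def)
  qed
  note q = this
  show ?thesis
  proof (cases "c (Suc (Suc k)) = 0")
    case True
    have "c (Suc k) = 0"
    proof (rule ccontr)
      assume nz: "c (Suc k) \<noteq> 0"
      \<comment> \<open>The quadratic term vanishes, and this choice of \<open>r\<close> makes the
        left side of \<open>q\<close> equal to -1.\<close>
      show False using q[of "(c k + 1) / (2 * c (Suc k))"] True nz by simp
    qed
    then show ?thesis using True by simp
  next
    case False
    have "0 \<le> c j" for j
    proof -
      have "p ^ (2 * j) = p ^ j * p ^ j" by (simp add: mult_2 power_add)
      then have "star x * p ^ (2 * j) * x = star (p ^ j * x) * (p ^ j * x)"
        by (simp add: star_mult star_power assms(1) mult.assoc)
      then show ?thesis unfolding c_def by (simp only: state_nonneg)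
    qed
    then have "0 \<le> c (Suc (Suc k))" .
    then have pos: "c (Suc (Suc k)) > 0" using False by simp
    have "0 \<le> c (Suc (Suc k)) * (c k - 2 * (c (Suc k) / c (Suc (Suc k))) * c (Suc k)
        + (c (Suc k) / c (Suc (Suc k)))\<^sup>2 * c (Suc (Suc k)))"
      by (intro mult_nonneg_nonneg less_imp_le[OF pos] q)
    also have "\<dots> = c k * c (Suc (Suc k)) - (c (Suc k))\<^sup>2"
      using pos by (simp add: field_simps power2_eq_square)
    finally show ?thesis by simp
  qed
qed

end

text \<open>Log-convexity makes successive ratios nondecreasing, so \<open>c\<close> grows at least
  geometrically with ratio \<open>c 1 / c 0\<close>; a ratio above \<open>L\<close> would contradict
  \<open>growth\<close>.\<close>

lemma log_convex_growth:
  fixes c :: "nat \<Rightarrow> real"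
  assumes nonneg: "\<And>k. 0 \<le> c k" and convex: "\<And>k. (c (Suc k))\<^sup>2 \<le> c k * c (Suc (Suc k))"
    and growth: "\<And>k. c k \<le> M * L ^ k" and L: "0 \<le> L"
  shows "c 1 \<le> L * c 0"
proof (cases "c 0 = 0 \<or> c 1 = 0")
  case True
  then show ?thesis using convex[of 0] nonneg[of 0] L by auto
next
  case False
  then have c0: "0 < c 0" and c1: "0 < c 1" using nonneg[of 0] nonneg[of 1] by auto
  define q where "q = c 1 / c 0"
  have q: "0 < q" using c0 c1 by (simp add: q_def)
  have step: "0 < c k \<and> q * c k \<le> c (Suc k)" for k
  proof (induction k)
    case 0
    then show ?case using c0 by (simp add: q_def)
  next
    case (Suc k)
    have pos: "0 < c (Suc k)" using Suc q mult_pos_pos[of q "c k"] by linarith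
    have "q * c (Suc k) * c k \<le> c (Suc k) * c (Suc k)"
      using Suc pos mult_right_mono[of "q * c k" "c (Suc k)" "c (Suc k)"] by (simp add: mult_ac)
    also have "\<dots> \<le> c k * c (Suc (Suc k))" using convex[of k] by (simp add: power2_eq_square)
    finally have "q * c (Suc k) \<le> c (Suc (Suc k))" using Suc by (simp add: mult.commute)
    then show ?case using pos by simp
  qed
  have lower: "c 0 * q ^ k \<le> c k" for k
  proof (induction k)
    case (Suc k)
    have "c 0 * q ^ Suc k = q * (c 0 * q ^ k)" by simp
    also have "\<dots> \<le> q * c k" using Suc q by (intro mult_left_mono) auto
    also have "\<dots> \<le> c (Suc k)" using step by blast
    finally show ?case .
  qed simp
  have "q \<le> L"
  proof (rule ccontr)
    assume "\<not> q \<le> L"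
    then have "L / q < 1" "0 \<le> L / q" using q L by auto
    then have "(\<lambda>k. M * (L / q) ^ k) \<longlonglongrightarrow> M * 0"
      by (intro tendsto_intros LIMSEQ_power_zero) auto
    moreover have "c 0 \<le> M * (L / q) ^ k" for k
      using order_trans[OF lower growth, of k] q by (simp add: power_divide field_simps)
    ultimately show False using c0 LIMSEQ_le_const[of _ "M * 0" "c 0"] by auto
  qed
  then show ?thesis using c0 by (simp add: q_def field_simps)
qed

context faithful_trace_cstar_prob_space
begin

text \<open>The trace property bounds \<open>\<tau> (x\<^sup>* p\<^sup>2\<^sup>n x)\<close> by \<open>\<parallel>x\<parallel>\<^sup>2 \<tau> (p\<^sup>2\<^sup>n)\<close>, so log-convexity gives
  \<open>\<tau> (x\<^sup>* (K\<^sup>2 - p\<^sup>2) x) \<ge> 0\<close> for every \<open>x\<close>. Taking for \<open>x\<close> the negative part of \<open>K\<^sup>2 - p\<^sup>2\<close>,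
  faithfulness shows that \<open>K\<^sup>2 - p\<^sup>2\<close> has a square root.\<close>

lemma norm_le_of_moments:
  assumes p: "star p = p" and K: "0 \<le> K" and mom: "\<And>n. Re (\<tau> (p ^ (2 * n))) \<le> K ^ (2 * n)"
  shows "norm p \<le> K"
proof -
  have key: "Re (\<tau> (star x * (p * p) * x)) \<le> K\<^sup>2 * Re (\<tau> (star x * x))" for x
  proof -
    let ?c = "\<lambda>k. Re (\<tau> (star x * p ^ (2 * k) * x))"
    have p2: "star (p ^ k) * p ^ k = p ^ (2 * k)" for k
      by (simp add: star_power p mult_2 power_add)
    have c: "star x * p ^ (2 * k) * x = star (p ^ k * x) * (p ^ k * x)" for k
      by (simp add: star_mult mult.assoc flip: p2)
    have "?c 1 \<le> K\<^sup>2 * ?c 0"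
    proof (rule log_convex_growth[where c = ?c and L = "K\<^sup>2" and M = "(norm x)\<^sup>2"])
      show "0 \<le> ?c k" for k unfolding c by (rule state_nonneg)
      show "(?c (Suc k))\<^sup>2 \<le> ?c k * ?c (Suc (Suc k))" for k
        by (rule state_Cauchy_Schwarz_powers[OF p])
      show "?c k \<le> (norm x)\<^sup>2 * (K\<^sup>2) ^ k" for k
      proof -
        have "\<tau> (star x * p ^ (2 * k) * x) = \<tau> (p ^ k * x * star (p ^ k * x))"
          unfolding c by (rule tracial)
        also have "\<dots> = \<tau> (star (star x * p ^ k) * (star x * p ^ k))"
          by (simp add: star_mult star_star star_power p mult.assoc)
        finally have "\<tau> (star x * p ^ (2 * k) * x) = \<tau> (star (star x * p ^ k) * (star x * p ^ k))" .
        then have "?c k \<le> (norm (star x))\<^sup>2 * Re (\<tau> (star (p ^ k) * p ^ k))"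
          using state_mult_le[of "star x" "p ^ k"] by (simp only:)
        also have "\<dots> \<le> (norm x)\<^sup>2 * K ^ (2 * k)"
          unfolding p2 using mom[of k] by (simp add: mult_left_mono)
        finally show ?thesis by (simp add: power_mult)
      qed
    qed simp
    then show ?thesis by (simp add: power2_eq_square)
  qed
  \<comment> \<open>The summand 1 keeps the normalising factor positive even if \<open>p * p\<close>
    is the scalar \<open>K\<^sup>2\<close>.\<close>
  define M where "M = norm (K\<^sup>2 *\<^sub>R 1 - p * p) + 1"
  have M: "M > 0" unfolding M_def by (smt (verit) norm_ge_zero)
  define q where "q = (1 / M) *\<^sub>R (K\<^sup>2 *\<^sub>R 1 - p * p)"
  have nq: "norm q \<le> 1" using M by (simp add: q_def M_def)
  have sq: "star q = q" by (simp add: q_def star_scaleR star_diff star_mult p)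
  have pq: "p * q = q * p" by (simp add: q_def algebra_simps)
  obtain w where w: "star w = w" "(w * w) * (w * w) = q * q" "\<And>c. c * q = q * c \<Longrightarrow> c * w = w * c"
    using sqrt_abs[OF nq sq] by blast
  have qw: "q * w = w * q" and pw: "p * w = w * p" using w(3)[OF pq] w(3)[of q] by simp_all
  \<comment> \<open>As \<open>w * w\<close> is the absolute value of \<open>q\<close>, this is twice
    the negative part of \<open>q\<close>; on it \<open>q\<close> acts as
    \<open>- (w * w)\<close>.\<close>
  define n where "n = w * w - q"
  have sn: "star n = n" by (simp add: n_def star_diff star_mult w(1) sq)
  have "w * w * q = w * (q * w)" by (simp only: mult.assoc qw)
  also have "\<dots> = w * q * w" by (simp only: mult.assoc)
  also have "\<dots> = q * w * w" by (simp only: qw)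
  finally have wwq: "w * w * q = q * (w * w)" by (simp only: mult.assoc)
  have "q * n = - (w * w * n)"
    by (simp only: n_def right_diff_distrib w(2) wwq minus_diff_eq)
  then have qn: "q * n = - (w * (w * n))" by (simp only: mult.assoc)
  have "star n * q * n = - (star (w * n) * (w * n))"
    by (simp add: star_mult w(1) mult.assoc qn)
  moreover have "0 \<le> Re (\<tau> (star n * q * n))"
  proof -
    have "star n * q * n = (1 / M) *\<^sub>R (K\<^sup>2 *\<^sub>R (star n * n) - star n * (p * p) * n)"
      by (simp add: q_def algebra_simps)
    then show ?thesis using key[of n] M by (simp add: state_scaleR state_diff)
  qed
  ultimately have "Re (\<tau> (star (w * n) * (w * n))) = 0"
    using state_nonneg[of "w * n"] by (simp add: state_minus)
  then have "\<tau> (star (w * n) * (w * n)) = 0"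
    using state_positive[of "w * n"] by (simp add: complex_nonneg_Reals_iff complex_eq_iff)
  then have wn0: "w * n = 0" by (rule faithful)
  have "q * n = 0" by (simp add: qn wn0)
  then have "n * n = 0"
    using wn0 by (subst (1) n_def) (simp add: left_diff_distrib mult.assoc)
  then have "n = 0" using sn self_adjoint_square_eq_zero by blast
  then have qww: "q = w * w" by (simp add: n_def)
  show ?thesis
  \<comment> \<open>The negative part is gone, so \<open>sqrt M *\<^sub>R w\<close> is a square root
    of \<open>K\<^sup>2 - p * p\<close> that commutes with \<open>p\<close>.\<close>
  proof (rule norm_le_of_sum_squares[where s = "sqrt M *\<^sub>R w"])
    have "K\<^sup>2 *\<^sub>R 1 - p * p = M *\<^sub>R q" using M by (simp add: q_def)
    then show "p * p + sqrt M *\<^sub>R w * sqrt M *\<^sub>R w = K\<^sup>2 *\<^sub>R 1"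
      using M by (simp add: qww algebra_simps)
  qed (simp_all add: star_scaleR p w(1) pw K)
qed

end


section \<open>The algebraic Fock space\<close>

typedef 'k fock = "{f :: 'k list \<Rightarrow> real. finite {w. f w \<noteq> 0}}"
  morphisms coeff Abs_fock
  by (rule exI[of _ "\<lambda>_. 0"]) simp

setup_lifting type_definition_fock

lemma fock_eqI: "(\<And>w. coeff f w = coeff g w) \<Longrightarrow> f = g"
  by (auto simp flip: coeff_inject)

lemma finite_supp: "finite {w. coeff f w \<noteq> 0}"
  using coeff[of f] by simp

instantiation fock :: (type) real_vector
begin

lift_definition zero_fock :: "'a fock" is "\<lambda>_. 0" by simp
lift_definition plus_fock :: "'a fock \<Rightarrow> 'a fock \<Rightarrow> 'a fock" is "\<lambda>f g w. f w + g w"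
  by (rule finite_subset[rotated, OF finite_UnI], assumption, assumption) auto
lift_definition uminus_fock :: "'a fock \<Rightarrow> 'a fock" is "\<lambda>f w. - f w" by simp
lift_definition minus_fock :: "'a fock \<Rightarrow> 'a fock \<Rightarrow> 'a fock" is "\<lambda>f g w. f w - g w"
  by (rule finite_subset[rotated, OF finite_UnI], assumption, assumption) auto
lift_definition scaleR_fock :: "real \<Rightarrow> 'a fock \<Rightarrow> 'a fock" is "\<lambda>r f w. r * f w"
  by (rule finite_subset) auto

instance
  by standard (transfer; auto simp: fun_eq_iff algebra_simps)+

end

lemmas coeff_simps [simp] =
  zero_fock.rep_eq plus_fock.rep_eq uminus_fock.rep_eq minus_fock.rep_eq scaleR_fock.rep_eq

lemma coeff_sum [simp]: "coeff (sum f A) w = (\<Sum>i\<in>A. coeff (f i) w)"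
  by (induction A rule: infinite_finite_induct) simp_all

instantiation fock :: (type) real_inner
begin

definition inner_fock :: "'a fock \<Rightarrow> 'a fock \<Rightarrow> real" where
  "inner_fock f g = (\<Sum>w | coeff f w \<noteq> 0. coeff f w * coeff g w)"
definition norm_fock :: "'a fock \<Rightarrow> real" where "norm_fock f = sqrt (inner f f)"
definition sgn_fock :: "'a fock \<Rightarrow> 'a fock" where "sgn_fock f = f /\<^sub>R norm f"
definition dist_fock :: "'a fock \<Rightarrow> 'a fock \<Rightarrow> real" where "dist_fock f g = norm (f - g)"
definition uniformity_fock :: "('a fock \<times> 'a fock) filter" where
  "uniformity_fock = (INF e\<in>{0<..}. principal {(f, g). dist f g < e})"
definition open_fock :: "'a fock set \<Rightarrow> bool" where
  "open_fock U \<longleftrightarrow> (\<forall>f\<in>U. eventually (\<lambda>(f', g). f' = f \<longrightarrow> g \<in> U) uniformity)"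

lemma inner_fock_eq:
  assumes "finite W" "{w. coeff f w \<noteq> 0} \<subseteq> W"
  shows "inner f g = (\<Sum>w\<in>W. coeff f w * coeff g w)"
  unfolding inner_fock_def by (rule sum.mono_neutral_left) (use assms in auto)

instance
proof
  fix f g h :: "'a fock" and r :: real
  let ?W = "{w. coeff f w \<noteq> 0} \<union> {w. coeff g w \<noteq> 0}"
  have W: "finite ?W" by (simp add: finite_supp)
  have eq: "inner a b = (\<Sum>w\<in>?W. coeff a w * coeff b w)" if "a \<in> {f, g, f + g}" for a b
    by (rule inner_fock_eq[OF W]) (use that in auto)
  show "inner f g = inner g f" by (simp add: eq mult.commute)
  show "inner (f + g) h = inner f h + inner g h"
    by (simp add: eq sum.distrib distrib_right)
  have "inner (r *\<^sub>R f) g = (\<Sum>w | coeff f w \<noteq> 0. coeff (r *\<^sub>R f) w * coeff g w)"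
    by (rule inner_fock_eq[OF finite_supp]) auto
  then show "inner (r *\<^sub>R f) g = r * inner f g"
    by (simp add: inner_fock_def sum_distrib_left mult.assoc)
  show "0 \<le> inner f f" by (simp add: inner_fock_def sum_nonneg)
  show "inner f f = 0 \<longleftrightarrow> f = 0"
  proof
    assume "inner f f = 0"
    then have "\<forall>w\<in>{w. coeff f w \<noteq> 0}. coeff f w * coeff f w = 0"
      unfolding inner_fock_def by (subst (asm) sum_nonneg_eq_0_iff) (auto simp: finite_supp)
    then show "f = 0" by (intro fock_eqI) auto
  qed (simp add: inner_fock_def)
qed (simp_all add: norm_fock_def sgn_fock_def dist_fock_def uniformity_fock_def open_fock_def)

end

section \<open>Creation, annihilation and parity operators\<close>

lift_definition ket :: "'k list \<Rightarrow> 'k fock" is "\<lambda>v w. if w = v then 1 else 0" by simp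

abbreviation vac :: "'k fock" where "vac \<equiv> ket []"

lift_definition create :: "'k \<Rightarrow> 'k fock \<Rightarrow> 'k fock" is
  "\<lambda>k f w. case w of [] \<Rightarrow> 0 | l # w' \<Rightarrow> if l = k then f w' else 0"
proof -
  fix k :: 'k and f :: "'k list \<Rightarrow> real" assume "finite {w. f w \<noteq> 0}"
  then show "finite {w. (case w of [] \<Rightarrow> 0 | l # w' \<Rightarrow> if l = k then f w' else 0) \<noteq> 0}"
    by (rule finite_surj[where f = "(#) k"]) (rule subsetI, case_tac x, auto split: if_splits)
qed

lift_definition annihilate :: "'k \<Rightarrow> 'k fock \<Rightarrow> 'k fock" is "\<lambda>k f w. f (k # w)"
proof -
  fix k :: 'k and f :: "'k list \<Rightarrow> real" assume "finite {w. f w \<noteq> 0}"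
  then show "finite {w. f (k # w) \<noteq> 0}"
    by (rule finite_surj[where f = tl]) (force simp: image_iff)
qed

lift_definition create_right :: "'k \<Rightarrow> 'k fock \<Rightarrow> 'k fock" is
  "\<lambda>k f w. if w \<noteq> [] \<and> last w = k then f (butlast w) else 0"
proof -
  fix k :: 'k and f :: "'k list \<Rightarrow> real" assume "finite {w. f w \<noteq> 0}"
  then show "finite {w. (if w \<noteq> [] \<and> last w = k then f (butlast w) else 0) \<noteq> 0}"
    by (rule finite_surj[where f = "\<lambda>w. w @ [k]"])
      (auto simp: image_iff split: if_splits intro!: exI[of _ "butlast _"])
qed

text \<open>The grading by word length. As \<open>gauss\<close> is odd for it, matrix coefficients
  between even and odd vectors will vanish.\<close>

lift_definition parity :: "'k fock \<Rightarrow> 'k fock" is "\<lambda>f w. (- 1) ^ length w * f w"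
  by simp

definition gauss :: "'k \<Rightarrow> 'k fock \<Rightarrow> 'k fock" where
  "gauss k f = create k f + annihilate k f"

lemma coeff_ket [simp]: "coeff (ket v) w = (if w = v then 1 else 0)"
  by (simp add: ket.rep_eq)

lemma coeff_create [simp]: "coeff (create k f) [] = 0"
  "coeff (create k f) (l # w) = (if l = k then coeff f w else 0)"
  by (simp_all add: create.rep_eq)

lemma coeff_annihilate [simp]: "coeff (annihilate k f) w = coeff f (k # w)"
  by (simp add: annihilate.rep_eq)

lemma coeff_create_right:
  "coeff (create_right k f) w = (if w \<noteq> [] \<and> last w = k then coeff f (butlast w) else 0)"
  by (simp add: create_right.rep_eq)

lemma coeff_parity [simp]: "coeff (parity f) w = (- 1) ^ length w * coeff f w"
  by (simp add: parity.rep_eq)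

lemma linear_create: "linear (create k)"
  by (intro linearI fock_eqI; case_tac w) auto

lemma linear_annihilate: "linear (annihilate k)"
  by (intro linearI fock_eqI) auto

lemma linear_create_right: "linear (create_right k)"
  by (intro linearI fock_eqI) (auto simp: coeff_create_right)

lemma linear_parity: "linear parity"
  by (intro linearI fock_eqI) (auto simp: algebra_simps)

lemma linear_gauss: "linear (gauss k)"
  unfolding gauss_def by (intro linear_compose_add linear_create linear_annihilate)

lemma inner_ket: "ket v \<bullet> f = coeff f v"
proof -
  have "{w. coeff (ket v) w \<noteq> 0} = {v}" by auto
  then show ?thesis by (simp add: inner_fock_def)
qed

lemma norm_ket [simp]: "norm (ket v) = 1"
  by (simp add: norm_eq_sqrt_inner inner_ket)

lemma inner_create: "create k f \<bullet> g = f \<bullet> annihilate k g"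
proof -
  have "create k f \<bullet> g = (\<Sum>w\<in>(#) k ` {w. coeff f w \<noteq> 0}. coeff (create k f) w * coeff g w)"
  proof (rule inner_fock_eq)
    show "{w. coeff (create k f) w \<noteq> 0} \<subseteq> (#) k ` {w. coeff f w \<noteq> 0}"
      by (rule subsetI, case_tac x) (auto split: if_splits)
  qed (simp add: finite_supp)
  also have "\<dots> = f \<bullet> annihilate k g"
    unfolding inner_fock_def by (subst sum.reindex) auto
  finally show ?thesis .
qed

lemma inner_annihilate: "annihilate k f \<bullet> g = f \<bullet> create k g"
  by (metis inner_commute inner_create)

lemma inner_gauss: "gauss k f \<bullet> g = f \<bullet> gauss k g"
  by (simp add: gauss_def inner_add_left inner_add_right inner_create inner_annihilate)

lemma annihilate_create: "annihilate k (create l f) = (if k = l then f else 0)"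
  by (intro fock_eqI) auto

lemma inner_create_create: "create k f \<bullet> create l g = (if k = l then f \<bullet> g else 0)"
  by (simp add: inner_create annihilate_create)

lemma norm_create_right [simp]: "norm (create_right k f) = norm f"
proof -
  let ?W = "(\<lambda>w. w @ [k]) ` {w. coeff f w \<noteq> 0}"
  have "create_right k f \<bullet> create_right k f
      = (\<Sum>w\<in>?W. coeff (create_right k f) w * coeff (create_right k f) w)"
  proof (rule inner_fock_eq)
    show "{w. coeff (create_right k f) w \<noteq> 0} \<subseteq> ?W"
      by (auto simp: coeff_create_right image_iff split: if_splits intro!: exI[of _ "butlast _"])
  qed (simp add: finite_supp)
  also have "\<dots> = f \<bullet> f"
    unfolding inner_fock_def by (subst sum.reindex) (auto simp: coeff_create_right inj_on_def)
  finally show ?thesis by (simp add: norm_eq_sqrt_inner)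
qed

lemma inner_parity: "parity f \<bullet> parity g = f \<bullet> g"
proof -
  have "(- 1) ^ n * a * ((- 1) ^ n * b) = a * b" for n and a b :: real
  proof -
    have "(- 1) ^ n * (- 1) ^ n = (1 :: real)" by (simp flip: power_mult_distrib)
    then show ?thesis by (metis mult.assoc mult.left_commute mult_1)
  qed
  moreover have "{w. coeff (parity f) w \<noteq> 0} = {w. coeff f w \<noteq> 0}" by simp
  ultimately show ?thesis by (simp only: inner_fock_def coeff_parity)
qed

lemma parity_gauss: "parity (gauss k f) = - gauss k (parity f)"
  by (intro fock_eqI, case_tac w) (auto simp: gauss_def algebra_simps)

text \<open>On the vacuum left and right creation agree; this lets vectors produced from the left be
  rewritten with right creation operators.\<close>

lemma gauss_vac: "gauss k vac = create_right k vac"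
  by (intro fock_eqI, case_tac w) (auto simp: gauss_def coeff_create_right)

text \<open>\<open>gauss\<close> acts on the first letter and \<open>create_right\<close> on the
  last. They interfere only on the empty word, where the letter just appended is also the first one
  and can be annihilated.\<close>

lemma gauss_create_right:
  "gauss j (create_right k f) =
    create_right k (gauss j f) + (if j = k then coeff f [] else 0) *\<^sub>R vac"
  by (intro fock_eqI, case_tac w) (auto simp: gauss_def coeff_create_right)


section \<open>The Fock space model\<close>

text \<open>The counterparts of \<open>x\<close>, \<open>x\<^sup>*\<close> and \<open>x x\<^sup>* + b\<close>, acting on vectors with entries in the Fock space.\<close>

definition noise :: "real^'m^'d \<Rightarrow> ('d \<times> 'm) fock^'m \<Rightarrow> ('d \<times> 'm) fock^'d" where
  "noise \<sigma> \<eta> = (\<chi> i. \<Sum>j\<in>UNIV. \<sigma> $ i $ j *\<^sub>R gauss (i, j) (\<eta> $ j))"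

definition noise_adj :: "real^'m^'d \<Rightarrow> ('d \<times> 'm) fock^'d \<Rightarrow> ('d \<times> 'm) fock^'m" where
  "noise_adj \<sigma> \<zeta> = (\<chi> j. \<Sum>i\<in>UNIV. \<sigma> $ i $ j *\<^sub>R gauss (i, j) (\<zeta> $ i))"

definition model :: "real^'m^'d \<Rightarrow> real^'d \<Rightarrow> ('d \<times> 'm) fock^'d \<Rightarrow> ('d \<times> 'm) fock^'d" where
  "model \<sigma> b \<zeta> = noise \<sigma> (noise_adj \<sigma> \<zeta>) + (\<chi> i. b $ i *\<^sub>R \<zeta> $ i)"

lemma linear_noise: "linear (noise \<sigma>)"
  by (intro linearI)
    (simp_all add: noise_def vec_eq_iff linear_add[OF linear_gauss] linear_scale[OF linear_gauss]
      sum.distrib scaleR_sum_right algebra_simps)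

lemma linear_noise_adj: "linear (noise_adj \<sigma>)"
  by (intro linearI)
    (simp_all add: noise_adj_def vec_eq_iff linear_add[OF linear_gauss] linear_scale[OF linear_gauss]
      sum.distrib scaleR_sum_right algebra_simps)

lemma linear_model: "linear (model \<sigma> b)"
  by (intro linearI)
    (simp_all add: model_def vec_eq_iff linear_add[OF linear_noise] linear_scale[OF linear_noise]
      linear_add[OF linear_noise_adj] linear_scale[OF linear_noise_adj] algebra_simps)

lemma inner_noise: "noise \<sigma> \<eta> \<bullet> \<zeta> = \<eta> \<bullet> noise_adj \<sigma> \<zeta>"
proof -
  have "noise \<sigma> \<eta> \<bullet> \<zeta> = (\<Sum>i\<in>UNIV. \<Sum>j\<in>UNIV. \<sigma> $ i $ j * (\<eta> $ j \<bullet> gauss (i, j) (\<zeta> $ i)))"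
    by (simp add: inner_vec_def noise_def inner_sum_left inner_gauss)
  also have "\<dots> = (\<Sum>j\<in>UNIV. \<Sum>i\<in>UNIV. \<sigma> $ i $ j * (\<eta> $ j \<bullet> gauss (i, j) (\<zeta> $ i)))"
    by (rule sum.swap)
  also have "\<dots> = \<eta> \<bullet> noise_adj \<sigma> \<zeta>"
    by (simp add: inner_vec_def noise_adj_def inner_sum_right)
  finally show ?thesis .
qed

lemma inner_model_self:
  "model \<sigma> b \<zeta> \<bullet> \<zeta> =
    noise_adj \<sigma> \<zeta> \<bullet> noise_adj \<sigma> \<zeta> + (\<Sum>i\<in>UNIV. b $ i * (\<zeta> $ i \<bullet> \<zeta> $ i))"
  by (simp add: model_def inner_add_left inner_noise) (simp add: inner_vec_def)

lemma inner_model: "model \<sigma> b \<zeta> \<bullet> \<theta> = \<zeta> \<bullet> model \<sigma> b \<theta>"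
proof -
  have "noise \<sigma> (noise_adj \<sigma> \<zeta>) \<bullet> \<theta> = \<zeta> \<bullet> noise \<sigma> (noise_adj \<sigma> \<theta>)"
    by (metis inner_commute inner_noise)
  then show ?thesis
    by (simp add: model_def inner_add_left inner_add_right) (simp add: inner_vec_def)
qed

section \<open>Bounds for the quadratic form of the model\<close>

lemma weighted_AM_GM_inner:
  fixes x y :: "'a::real_inner"
  assumes "0 < v"
  shows "2 * (x \<bullet> y) \<le> v * (x \<bullet> x) + (1 / v) * (y \<bullet> y)"
proof -
  have "0 \<le> (v *\<^sub>R x - y) \<bullet> (v *\<^sub>R x - y)" by simp
  also have "\<dots> = v * (v * (x \<bullet> x) + (1 / v) * (y \<bullet> y) - 2 * (x \<bullet> y))"
    using assms by (simp add: inner_diff_left inner_diff_right inner_commute[of y x] algebra_simps)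
  finally show ?thesis using assms by (simp add: zero_le_mult_iff)
qed

text \<open>Creation operators with different labels have orthogonal ranges, so the cross terms
  vanish.\<close>

lemma inner_sum_create_self:
  assumes "inj k" "finite A"
  shows "(\<Sum>i\<in>A. c i *\<^sub>R create (k i) (f i)) \<bullet> (\<Sum>i\<in>A. c i *\<^sub>R create (k i) (f i))
    = (\<Sum>i\<in>A. (c i)\<^sup>2 * (f i \<bullet> f i))"
proof -
  have "(\<Sum>i\<in>A. c i *\<^sub>R create (k i) (f i)) \<bullet> (\<Sum>l\<in>A. c l *\<^sub>R create (k l) (f l))
      = (\<Sum>l\<in>A. \<Sum>i\<in>A. c l * (c i * (if i = l then f i \<bullet> f l else 0)))"
    using assms(1) unfolding inner_sum_left inner_sum_right
    by (simp add: inner_create_create inj_eq)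
  also have "\<dots> = (\<Sum>l\<in>A. \<Sum>i\<in>A. if i = l then c l * (c i * (f i \<bullet> f l)) else 0)"
    by (intro sum.cong) auto
  also have "\<dots> = (\<Sum>i\<in>A. (c i)\<^sup>2 * (f i \<bullet> f i))"
    using assms(2) by (simp add: power2_eq_square mult.assoc)
  finally show ?thesis .
qed

text \<open>Splitting \<open>s = l + l\<^sup>*\<close> turns \<open>x\<^sup>*\<close> into \<open>noise_create + noise_annihilate\<close>, where
  \<open>noise_annihilate\<close> is the adjoint of \<open>noise_create'\<close>.\<close>

definition noise_create :: "real^'m^'d \<Rightarrow> ('d \<times> 'm) fock^'d \<Rightarrow> 'm \<Rightarrow> ('d \<times> 'm) fock" where
  "noise_create \<sigma> \<zeta> j = (\<Sum>i\<in>UNIV. \<sigma> $ i $ j *\<^sub>R create (i, j) (\<zeta> $ i))"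

definition noise_annihilate :: "real^'m^'d \<Rightarrow> ('d \<times> 'm) fock^'d \<Rightarrow> 'm \<Rightarrow> ('d \<times> 'm) fock" where
  "noise_annihilate \<sigma> \<zeta> j = (\<Sum>i\<in>UNIV. \<sigma> $ i $ j *\<^sub>R annihilate (i, j) (\<zeta> $ i))"

definition noise_create' :: "real^'m^'d \<Rightarrow> ('m \<Rightarrow> ('d \<times> 'm) fock) \<Rightarrow> 'd \<Rightarrow> ('d \<times> 'm) fock" where
  "noise_create' \<sigma> \<eta> i = (\<Sum>j\<in>UNIV. \<sigma> $ i $ j *\<^sub>R create (i, j) (\<eta> j))"

lemma noise_adj_split: "noise_adj \<sigma> \<zeta> $ j = noise_create \<sigma> \<zeta> j + noise_annihilate \<sigma> \<zeta> j"
  by (simp add: noise_adj_def noise_create_def noise_annihilate_def gauss_def sum.distrib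
      scaleR_add_right)

lemma inner_noise_annihilate:
  "(\<Sum>j\<in>UNIV. \<eta> j \<bullet> noise_annihilate \<sigma> \<zeta> j) = (\<Sum>i\<in>UNIV. noise_create' \<sigma> \<eta> i \<bullet> \<zeta> $ i)"
proof -
  have "(\<Sum>j\<in>UNIV. \<eta> j \<bullet> noise_annihilate \<sigma> \<zeta> j)
      = (\<Sum>j\<in>UNIV. \<Sum>i\<in>UNIV. \<sigma> $ i $ j * (\<eta> j \<bullet> annihilate (i, j) (\<zeta> $ i)))"
    by (simp add: noise_annihilate_def inner_sum_right)
  also have "\<dots> = (\<Sum>i\<in>UNIV. \<Sum>j\<in>UNIV. \<sigma> $ i $ j * (\<eta> j \<bullet> annihilate (i, j) (\<zeta> $ i)))"
    by (rule sum.swap)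
  finally show ?thesis by (simp add: noise_create'_def inner_sum_left inner_create)
qed

lemma inner_noise_create_self:
  "noise_create \<sigma> \<zeta> j \<bullet> noise_create \<sigma> \<zeta> j = (\<Sum>i\<in>UNIV. (\<sigma> $ i $ j)\<^sup>2 * (\<zeta> $ i \<bullet> \<zeta> $ i))"
  unfolding noise_create_def by (rule inner_sum_create_self) (auto simp: inj_def)

lemma inner_noise_create'_self:
  "noise_create' \<sigma> \<eta> i \<bullet> noise_create' \<sigma> \<eta> i = (\<Sum>j\<in>UNIV. (\<sigma> $ i $ j)\<^sup>2 * (\<eta> j \<bullet> \<eta> j))"
  unfolding noise_create'_def by (rule inner_sum_create_self) (auto simp: inj_def)

text \<open>Origin of the column sums in \<open>objective\<close>: weighting the rows by
  \<open>v\<close> and exchanging the sums leaves each \<open>\<eta> j\<close> with weight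
  \<open>\<Sum>k\<in>UNIV. (\<sigma> $ k $ j)\<^sup>2 * v $ k\<close>.\<close>

lemma weighted_sum_noise_create':
  "(\<Sum>i\<in>UNIV. v $ i * (noise_create' \<sigma> \<eta> i \<bullet> noise_create' \<sigma> \<eta> i))
    = (\<Sum>j\<in>UNIV. (\<Sum>k\<in>UNIV. (\<sigma> $ k $ j)\<^sup>2 * v $ k) * (\<eta> j \<bullet> \<eta> j))"
proof -
  have "(\<Sum>i\<in>UNIV. v $ i * (noise_create' \<sigma> \<eta> i \<bullet> noise_create' \<sigma> \<eta> i))
    = (\<Sum>i\<in>UNIV. \<Sum>j\<in>UNIV. (\<sigma> $ i $ j)\<^sup>2 * v $ i * (\<eta> j \<bullet> \<eta> j))"
    by (simp add: inner_noise_create'_self sum_distrib_left mult_ac)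
  also have "\<dots> = (\<Sum>j\<in>UNIV. \<Sum>i\<in>UNIV. (\<sigma> $ i $ j)\<^sup>2 * v $ i * (\<eta> j \<bullet> \<eta> j))"
    by (rule sum.swap)
  finally show ?thesis by (simp add: sum_distrib_right)
qed

text \<open>Regrouping the last term of \<open>objective\<close> by columns turns each fraction into
  the weight of one vector \<open>noise_create \<sigma> \<zeta> j\<close>.\<close>

lemma sum_objective:
  "(\<Sum>i\<in>UNIV. objective \<sigma> b v $ i * (\<zeta> $ i \<bullet> \<zeta> $ i)) =
    (\<Sum>i\<in>UNIV. b $ i * (\<zeta> $ i \<bullet> \<zeta> $ i)) + (\<Sum>i\<in>UNIV. (1 / v $ i) * (\<zeta> $ i \<bullet> \<zeta> $ i)) +
    (\<Sum>j\<in>UNIV. 1 / (1 - (\<Sum>k\<in>UNIV. (\<sigma> $ k $ j)\<^sup>2 * v $ k)) *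
      (noise_create \<sigma> \<zeta> j \<bullet> noise_create \<sigma> \<zeta> j))"
proof -
  let ?h = "\<lambda>j. 1 / (1 - (\<Sum>k\<in>UNIV. (\<sigma> $ k $ j)\<^sup>2 * v $ k))"
  have "(\<Sum>j\<in>UNIV. ?h j * (noise_create \<sigma> \<zeta> j \<bullet> noise_create \<sigma> \<zeta> j)) =
      (\<Sum>j\<in>UNIV. \<Sum>i\<in>UNIV. (\<sigma> $ i $ j)\<^sup>2 * ?h j * (\<zeta> $ i \<bullet> \<zeta> $ i))"
    unfolding inner_noise_create_self sum_distrib_left by (simp add: mult_ac)
  also have "\<dots> = (\<Sum>i\<in>UNIV. \<Sum>j\<in>UNIV. (\<sigma> $ i $ j)\<^sup>2 * ?h j * (\<zeta> $ i \<bullet> \<zeta> $ i))"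
    by (rule sum.swap)
  finally show ?thesis
    by (simp add: objective_def distrib_right sum.distrib sum_distrib_right)
qed

text \<open>Both bounds are completions of squares for \<open>s = l + l\<^sup>*\<close>; they use \<open>l\<^sub>i\<^sup>* l\<^sub>j = \<delta>\<^sub>i\<^sub>j\<close>.\<close>

lemma inner_model_le:
  assumes v: "\<And>i. 0 < v $ i" "\<And>j. (\<Sum>k\<in>UNIV. (\<sigma> $ k $ j)\<^sup>2 * v $ k) < 1"
    and c: "\<And>i. objective \<sigma> b v $ i \<le> c"
  shows "model \<sigma> b \<zeta> \<bullet> \<zeta> \<le> c * (\<zeta> \<bullet> \<zeta>)"
proof -
  define u where "u j = (\<Sum>k\<in>UNIV. (\<sigma> $ k $ j)\<^sup>2 * v $ k)" for j
  define \<eta> where "\<eta> j = noise_adj \<sigma> \<zeta> $ j" for j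
  let ?C = "noise_create \<sigma> \<zeta>" and ?A = "noise_annihilate \<sigma> \<zeta>" and ?L = "noise_create' \<sigma> \<eta>"
  have u: "0 < 1 - u j" for j using v(2) by (simp add: u_def)
  have \<eta>: "\<eta> j \<bullet> \<eta> j = \<eta> j \<bullet> ?C j + \<eta> j \<bullet> ?A j" for j
    by (simp add: \<eta>_def noise_adj_split inner_add_right)
  have "2 * (\<Sum>j\<in>UNIV. \<eta> j \<bullet> \<eta> j)
      = (\<Sum>j\<in>UNIV. 2 * (\<eta> j \<bullet> ?C j)) + (\<Sum>i\<in>UNIV. 2 * (?L i \<bullet> \<zeta> $ i))"
    unfolding \<eta> sum.distrib inner_noise_annihilate by (simp add: sum_distrib_left)
  \<comment> \<open>The weight \<open>1 - u j\<close>, positive by feasibility, complements the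
    weight \<open>u j\<close> that the \<open>?L\<close> terms contribute: each
    \<open>\<eta> j \<bullet> \<eta> j\<close> occurs with total weight 1 and cancels one of the two
    copies on the left.\<close>
  also have "(\<Sum>j\<in>UNIV. 2 * (\<eta> j \<bullet> ?C j))
      \<le> (\<Sum>j\<in>UNIV. (1 - u j) * (\<eta> j \<bullet> \<eta> j) + 1 / (1 - u j) * (?C j \<bullet> ?C j))"
    by (intro sum_mono weighted_AM_GM_inner u)
  also have "(\<Sum>i\<in>UNIV. 2 * (?L i \<bullet> \<zeta> $ i))
      \<le> (\<Sum>i\<in>UNIV. v $ i * (?L i \<bullet> ?L i) + 1 / v $ i * (\<zeta> $ i \<bullet> \<zeta> $ i))"
    by (intro sum_mono weighted_AM_GM_inner v)
  finally have "(\<Sum>j\<in>UNIV. \<eta> j \<bullet> \<eta> j) \<le>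
      (\<Sum>j\<in>UNIV. 1 / (1 - u j) * (?C j \<bullet> ?C j)) + (\<Sum>i\<in>UNIV. 1 / v $ i * (\<zeta> $ i \<bullet> \<zeta> $ i))"
    unfolding sum.distrib weighted_sum_noise_create' u_def[symmetric] left_diff_distrib sum_subtractf
    by simp
  then have "model \<sigma> b \<zeta> \<bullet> \<zeta> \<le> (\<Sum>i\<in>UNIV. objective \<sigma> b v $ i * (\<zeta> $ i \<bullet> \<zeta> $ i))"
    unfolding sum_objective inner_model_self by (simp add: inner_vec_def \<eta>_def u_def)
  also have "\<dots> \<le> (\<Sum>i\<in>UNIV. c * (\<zeta> $ i \<bullet> \<zeta> $ i))"
    by (intro sum_mono mult_right_mono c) simp
  finally show ?thesis by (simp add: inner_vec_def sum_distrib_left)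
qed

lemma inner_model_ge:
  assumes v: "\<And>i. v $ i < 0" and c: "\<And>i. c \<le> objective \<sigma> b v $ i"
  shows "c * (\<zeta> \<bullet> \<zeta>) \<le> model \<sigma> b \<zeta> \<bullet> \<zeta>"
proof -
  define h where "h j = 1 / (1 - (\<Sum>k\<in>UNIV. (\<sigma> $ k $ j)\<^sup>2 * v $ k))" for j
  define \<eta> where "\<eta> j = noise_adj \<sigma> \<zeta> $ j" for j
  let ?C = "noise_create \<sigma> \<zeta>" and ?A = "noise_annihilate \<sigma> \<zeta>"
  \<comment> \<open>With this test vector the weights 1 and \<open>1 / h j - 1\<close> of
    \<open>\<theta> j \<bullet> \<theta> j\<close> below add up to \<open>1 / h j\<close>, so these
    terms return exactly one of the two copies of \<open>h j * (?C j \<bullet> ?C j)\<close> on the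
    left.\<close>
  define \<theta> where "\<theta> j = - h j *\<^sub>R ?C j" for j
  let ?L = "noise_create' \<sigma> \<theta>"
  have "(\<Sum>k\<in>UNIV. (\<sigma> $ k $ j)\<^sup>2 * v $ k) \<le> 0" for j
    by (intro sum_nonpos mult_nonneg_nonpos) (use v in \<open>auto intro: less_imp_le\<close>)
  then have "(\<Sum>k\<in>UNIV. (\<sigma> $ k $ j)\<^sup>2 * v $ k) \<noteq> 1" for j
    by (metis not_one_le_zero)
  then have h: "h j \<noteq> 0" "(\<Sum>k\<in>UNIV. (\<sigma> $ k $ j)\<^sup>2 * (- v) $ k) = 1 / h j - 1" for j
    by (simp_all add: h_def sum_negf)
  have C: "h j * (?C j \<bullet> ?C j) = - (\<theta> j \<bullet> \<eta> j) + \<theta> j \<bullet> ?A j" for j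
    by (simp add: \<eta>_def noise_adj_split inner_add_right \<theta>_def)
  have "2 * (\<Sum>j\<in>UNIV. h j * (?C j \<bullet> ?C j))
      = (\<Sum>j\<in>UNIV. 2 * ((- \<theta> j) \<bullet> \<eta> j)) + (\<Sum>i\<in>UNIV. 2 * (?L i \<bullet> \<zeta> $ i))"
    unfolding C sum.distrib inner_noise_annihilate
    by (simp add: sum_distrib_left)
  also have "(\<Sum>j\<in>UNIV. 2 * ((- \<theta> j) \<bullet> \<eta> j))
      \<le> (\<Sum>j\<in>UNIV. 1 * ((- \<theta> j) \<bullet> (- \<theta> j)) + 1 / 1 * (\<eta> j \<bullet> \<eta> j))"
    by (intro sum_mono weighted_AM_GM_inner) simp
  also have "(\<Sum>i\<in>UNIV. 2 * (?L i \<bullet> \<zeta> $ i))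
      \<le> (\<Sum>i\<in>UNIV. (- v) $ i * (?L i \<bullet> ?L i) + 1 / (- v) $ i * (\<zeta> $ i \<bullet> \<zeta> $ i))"
    by (intro sum_mono weighted_AM_GM_inner) (use v in simp)
  also have "(\<Sum>j\<in>UNIV. 1 * ((- \<theta> j) \<bullet> (- \<theta> j)) + 1 / 1 * (\<eta> j \<bullet> \<eta> j)) +
        (\<Sum>i\<in>UNIV. (- v) $ i * (?L i \<bullet> ?L i) + 1 / (- v) $ i * (\<zeta> $ i \<bullet> \<zeta> $ i)) =
      (\<Sum>j\<in>UNIV. \<eta> j \<bullet> \<eta> j) - (\<Sum>i\<in>UNIV. 1 / v $ i * (\<zeta> $ i \<bullet> \<zeta> $ i)) +
        (\<Sum>j\<in>UNIV. 1 / h j * (\<theta> j \<bullet> \<theta> j))"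
    unfolding sum.distrib weighted_sum_noise_create' h left_diff_distrib sum_subtractf
    by (simp add: sum_negf)
  also have "(\<Sum>j\<in>UNIV. 1 / h j * (\<theta> j \<bullet> \<theta> j)) = (\<Sum>j\<in>UNIV. h j * (?C j \<bullet> ?C j))"
    using h(1) by (simp add: \<theta>_def)
  finally have "(\<Sum>j\<in>UNIV. h j * (?C j \<bullet> ?C j)) + (\<Sum>i\<in>UNIV. 1 / v $ i * (\<zeta> $ i \<bullet> \<zeta> $ i))
      \<le> (\<Sum>j\<in>UNIV. \<eta> j \<bullet> \<eta> j)"
    by simp
  then have "(\<Sum>i\<in>UNIV. objective \<sigma> b v $ i * (\<zeta> $ i \<bullet> \<zeta> $ i)) \<le> model \<sigma> b \<zeta> \<bullet> \<zeta>"
    unfolding sum_objective inner_model_self by (simp add: inner_vec_def \<eta>_def h_def)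
  moreover have "(\<Sum>i\<in>UNIV. c * (\<zeta> $ i \<bullet> \<zeta> $ i)) \<le> (\<Sum>i\<in>UNIV. objective \<sigma> b v $ i * (\<zeta> $ i \<bullet> \<zeta> $ i))"
    by (intro sum_mono mult_right_mono c) simp
  ultimately show ?thesis by (simp add: inner_vec_def sum_distrib_left)
qed


section \<open>Positive contractions and Neumann series\<close>

text \<open>For 0 \<le> A \<le> r this is A^2 \<le> r A. The form of \<open>A\<close> at
  \<open>x - t *\<^sub>R A x\<close> is nonnegative; bounding its quadratic term by
  \<open>le\<close> and taking \<open>t = 1 / r\<close> gives the first claim, from which the second
  follows by \<open>le\<close> again. For \<open>r = 0\<close> the choice \<open>t = 1\<close>
  suffices.\<close>

lemma norm_le_of_form_bounds:
  fixes A :: "'v::real_inner \<Rightarrow> 'v"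
  assumes A: "linear A" and sym: "\<And>x y. A x \<bullet> y = x \<bullet> A y"
    and pos: "\<And>x. 0 \<le> A x \<bullet> x" and le: "\<And>x. A x \<bullet> x \<le> r * (x \<bullet> x)" and r: "0 \<le> r"
  shows "(norm (A x))\<^sup>2 \<le> r * (A x \<bullet> x)" and "norm (A x) \<le> r * norm x"
proof -
  have q: "0 \<le> A x \<bullet> x - 2 * t * (A x \<bullet> A x) + t\<^sup>2 * (r * (A x \<bullet> A x))" for t
  proof -
    have "A x \<bullet> A (A x) = A (A x) \<bullet> A x" by (rule inner_commute)
    then have "A (x - t *\<^sub>R A x) \<bullet> (x - t *\<^sub>R A x) =
        A x \<bullet> x - 2 * t * (A x \<bullet> A x) + t\<^sup>2 * (A (A x) \<bullet> A x)"
      by (simp add: linear_diff[OF A] linear_scale[OF A] inner_diff_left inner_diff_right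
          sym[of "A x" x] algebra_simps power2_eq_square)
    then show ?thesis
      using pos[of "x - t *\<^sub>R A x"] mult_left_mono[OF le[of "A x"], of "t\<^sup>2"] by simp
  qed
  show 1: "(norm (A x))\<^sup>2 \<le> r * (A x \<bullet> x)"
  proof (cases "r = 0")
    case True
    then have "A x \<bullet> x = 0" using pos[of x] le[of x] by simp
    then show ?thesis using q[of 1] True by (simp add: power2_norm_eq_inner)
  next
    case False
    then have "0 < r" using r by simp
    then have "0 \<le> r * (A x \<bullet> x - 2 * (1 / r) * (A x \<bullet> A x) + (1 / r)\<^sup>2 * (r * (A x \<bullet> A x)))"
      by (intro mult_nonneg_nonneg q) simp
    also have "\<dots> = r * (A x \<bullet> x) - A x \<bullet> A x"
      using \<open>0 < r\<close> by (simp add: field_simps power2_eq_square)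
    finally show ?thesis by (simp add: power2_norm_eq_inner)
  qed
  note 1
  also have "r * (A x \<bullet> x) \<le> r * (r * (x \<bullet> x))" by (rule mult_left_mono[OF le r])
  also have "\<dots> = (r * norm x)\<^sup>2"
    by (simp only: power_mult_distrib power2_norm_eq_inner power2_eq_square[of r] mult.assoc)
  finally show "norm (A x) \<le> r * norm x"
    by (rule power2_le_imp_le) (simp add: r)
qed

locale linear_contraction =
  fixes A :: "'v::real_inner \<Rightarrow> 'v" and \<rho> :: real
  assumes linear: "linear A" and norm_le: "norm (A x) \<le> \<rho> * norm x"
    and \<rho>: "0 \<le> \<rho>" "\<rho> < 1"
begin

definition neumann :: "nat \<Rightarrow> 'v \<Rightarrow> 'v" where
  "neumann n x = (\<Sum>k<n. (A ^^ k) x)"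

text \<open>The matrix coefficient of \<open>(1 - A)\<^sup>-\<^sup>1\<close>, an operator which exists only on the completion.\<close>

definition resolvent_form :: "'v \<Rightarrow> 'v \<Rightarrow> real" where
  "resolvent_form x y = (\<Sum>k. x \<bullet> (A ^^ k) y)"

lemma linear_funpow: "linear (A ^^ k)"
proof (induction k)
  case (Suc k)
  then show ?case using linear_compose[OF Suc linear] by (simp add: o_def)
qed (simp add: linear_id flip: id_def)

lemma linear_neumann: "linear (neumann n)"
  unfolding neumann_def by (intro linear_compose_sum ballI linear_funpow)

lemma norm_funpow_le: "norm ((A ^^ k) x) \<le> \<rho> ^ k * norm x"
proof (induction k)
  case (Suc k)
  have "norm (A ((A ^^ k) x)) \<le> \<rho> * norm ((A ^^ k) x)" by (rule norm_le)
  also have "\<dots> \<le> \<rho> * (\<rho> ^ k * norm x)" by (rule mult_left_mono[OF Suc \<rho>(1)])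
  finally show ?case by (simp add: mult.assoc)
qed simp

lemma norm_neumann_le: "norm (neumann n x) \<le> norm x / (1 - \<rho>)"
proof -
  have "norm (neumann n x) \<le> (\<Sum>k<n. \<rho> ^ k * norm x)"
    unfolding neumann_def by (rule order_trans[OF norm_sum sum_mono[OF norm_funpow_le]])
  also have "\<dots> = (\<Sum>k<n. \<rho> ^ k) * norm x" by (simp add: sum_distrib_right)
  also have "\<dots> \<le> (\<Sum>k. \<rho> ^ k) * norm x"
    by (intro mult_right_mono sum_le_suminf summable_geometric) (use \<rho> in auto)
  also have "\<dots> = norm x / (1 - \<rho>)" using \<rho> by (simp add: suminf_geometric)
  finally show ?thesis .
qed

lemma summable_inner_funpow: "summable (\<lambda>k. x \<bullet> (A ^^ k) y)"
proof (rule summable_comparison_test'[where N = 0])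
  show "summable (\<lambda>k. norm x * (\<rho> ^ k * norm y))"
    using \<rho> by (intro summable_mult summable_mult2 summable_geometric) simp
  show "norm (x \<bullet> (A ^^ n) y) \<le> norm x * (\<rho> ^ n * norm y)" for n
    using order_trans[OF Cauchy_Schwarz_ineq2 mult_left_mono[OF norm_funpow_le norm_ge_zero]]
    by simp
qed

lemma tendsto_resolvent_form: "(\<lambda>n. x \<bullet> neumann n y) \<longlonglongrightarrow> resolvent_form x y"
  unfolding neumann_def resolvent_form_def inner_sum_right
  by (rule summable_LIMSEQ[OF summable_inner_funpow])

lemma resolvent_form_add: "resolvent_form x (y + z) = resolvent_form x y + resolvent_form x z"
  unfolding resolvent_form_def
  by (simp add: linear_add[OF linear_funpow] inner_add_right suminf_add summable_inner_funpow)

lemma resolvent_form_scaleR: "resolvent_form x (c *\<^sub>R y) = c * resolvent_form x y"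
  unfolding resolvent_form_def
  by (simp add: linear_scale[OF linear_funpow] suminf_mult summable_inner_funpow)

lemma resolvent_form_zero: "resolvent_form x 0 = 0"
  using resolvent_form_scaleR[of x 0 0] by simp

lemma resolvent_form_sum: "resolvent_form x (\<Sum>i\<in>I. f i) = (\<Sum>i\<in>I. resolvent_form x (f i))"
  by (induction I rule: infinite_finite_induct) (simp_all add: resolvent_form_zero resolvent_form_add)

lemma resolvent_form_step: "resolvent_form x y = x \<bullet> y + resolvent_form x (A y)"
proof -
  have "resolvent_form x y = (\<Sum>k. x \<bullet> (A ^^ Suc k) y) + x \<bullet> (A ^^ 0) y"
    unfolding resolvent_form_def using suminf_split_head[OF summable_inner_funpow[of x y]] by simp
  also have "(\<lambda>k. x \<bullet> (A ^^ Suc k) y) = (\<lambda>k. x \<bullet> (A ^^ k) (A y))"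
    by (simp only: funpow_Suc_right o_apply)
  finally show ?thesis by (simp add: resolvent_form_def)
qed

lemma neumann_minus: "neumann n (x - A x) = x - (A ^^ n) x"
proof -
  have "neumann n (x - A x) = (\<Sum>k<n. (A ^^ k) x - (A ^^ Suc k) x)"
    by (simp only: neumann_def linear_diff[OF linear_funpow] funpow_Suc_right o_apply)
  then show ?thesis using sum_lessThan_telescope'[of "\<lambda>k. (A ^^ k) x" n] by simp
qed

lemma minus_neumann: "neumann n x - A (neumann n x) = x - (A ^^ n) x"
proof -
  have "A (neumann n x) = neumann n (A x)"
    by (simp add: neumann_def linear_sum[OF linear] funpow_swap1)
  then show ?thesis using neumann_minus[of n x] by (simp add: linear_diff[OF linear_neumann])
qed

text \<open>This is \<open>[(1 - A)\<^sup>-\<^sup>1, R] = (1 - A)\<^sup>-\<^sup>1 [A, R] (1 - A)\<^sup>-\<^sup>1\<close> for the Neumann sums.\<close>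

lemma neumann_commutator:
  assumes R: "linear R" and D: "\<And>x. D x = A (R x) - R (A x)"
  shows "neumann n (R x) - R (neumann n x) - neumann n (D (neumann n x)) =
    neumann n (R ((A ^^ n) x)) - (A ^^ n) (R (neumann n x))"
proof -
  let ?q = "neumann n x"
  have "R ?q - A (R ?q) = R (?q - A ?q) - D ?q"
    by (simp add: D linear_diff[OF R])
  also have "\<dots> = R x - R ((A ^^ n) x) - D ?q"
    by (simp add: minus_neumann linear_diff[OF R])
  finally have "neumann n (R ?q - A (R ?q)) = neumann n (R x) - neumann n (R ((A ^^ n) x))
      - neumann n (D ?q)"
    by (simp add: linear_diff[OF linear_neumann])
  then show ?thesis by (simp add: neumann_minus algebra_simps)
qed

text \<open>Here \<open>D\<close> says that the commutator of \<open>A\<close> and \<open>R\<close>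
  has rank at most two, so (1 - A)^-1 [A, R] (1 - A)^-1 splits into products of matrix coefficients.
  The hypothesis on \<open>x\<close> says that the adjoint of \<open>R\<close> sends
  \<open>x\<close> to a multiple of \<open>a\<close>.\<close>

lemma resolvent_form_commutator:
  assumes R: "linear R" "\<And>x. norm (R x) = norm x"
    and D: "\<And>y. A (R y) - R (A y) = s *\<^sub>R ((c \<bullet> y) *\<^sub>R a + (a \<bullet> y) *\<^sub>R c)"
    and x: "\<And>y. x \<bullet> R y = \<mu> * (a \<bullet> y)"
  shows "resolvent_form x (R y) = \<mu> * resolvent_form a y +
    s * (resolvent_form c y * resolvent_form x a + resolvent_form a y * resolvent_form x c)"
proof -
  \<comment> \<open>The remainder of the resolvent identity for truncated series; each of its two
    terms contains a power \<open>A ^^ n\<close>, hence decays like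
    \<open>\<rho> ^ n\<close>.\<close>
  define err where "err n = neumann n (R ((A ^^ n) y)) - (A ^^ n) (R (neumann n y))" for n
  have "norm (err n) \<le> 2 * (norm y / (1 - \<rho>)) * \<rho> ^ n" for n
  proof -
    have "norm (neumann n (R ((A ^^ n) y))) \<le> norm ((A ^^ n) y) / (1 - \<rho>)"
      using norm_neumann_le[of n "R ((A ^^ n) y)"] by (simp add: R)
    also have "\<dots> \<le> \<rho> ^ n * norm y / (1 - \<rho>)"
      using \<rho> by (intro divide_right_mono norm_funpow_le) simp
    finally have 1: "norm (neumann n (R ((A ^^ n) y))) \<le> \<rho> ^ n * norm y / (1 - \<rho>)" .
    have "norm ((A ^^ n) (R (neumann n y))) \<le> \<rho> ^ n * norm (neumann n y)"
      using norm_funpow_le[of n "R (neumann n y)"] by (simp add: R)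
    also have "\<dots> \<le> \<rho> ^ n * (norm y / (1 - \<rho>))"
      using \<rho> by (intro mult_left_mono norm_neumann_le) simp
    finally have "norm (err n) \<le> \<rho> ^ n * norm y / (1 - \<rho>) + \<rho> ^ n * (norm y / (1 - \<rho>))"
      unfolding err_def by (intro order_trans[OF norm_triangle_ineq4] add_mono 1)
    then show ?thesis by (simp add: mult_ac)
  qed
  moreover have "(\<lambda>n. 2 * (norm y / (1 - \<rho>)) * \<rho> ^ n) \<longlonglongrightarrow> 2 * (norm y / (1 - \<rho>)) * 0"
    using \<rho> by (intro tendsto_intros LIMSEQ_power_zero) simp
  ultimately have "err \<longlonglongrightarrow> 0"
    by (intro Lim_null_comparison[of err]) auto
  then have "(\<lambda>n. \<mu> * (a \<bullet> neumann n y) + s * ((c \<bullet> neumann n y) * (x \<bullet> neumann n a)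
      + (a \<bullet> neumann n y) * (x \<bullet> neumann n c)) + x \<bullet> err n) \<longlonglongrightarrow>
    \<mu> * resolvent_form a y + s * (resolvent_form c y * resolvent_form x a
      + resolvent_form a y * resolvent_form x c) + x \<bullet> 0"
    by (intro tendsto_add tendsto_mult tendsto_inner tendsto_const tendsto_resolvent_form)
  moreover have "x \<bullet> neumann n (R y) = \<mu> * (a \<bullet> neumann n y) + s * ((c \<bullet> neumann n y) * (x \<bullet> neumann n a)
      + (a \<bullet> neumann n y) * (x \<bullet> neumann n c)) + x \<bullet> err n" for n
  proof -
    have "neumann n (R y) = R (neumann n y) +
        s *\<^sub>R ((c \<bullet> neumann n y) *\<^sub>R neumann n a + (a \<bullet> neumann n y) *\<^sub>R neumann n c) + err n"
      using neumann_commutator[OF R(1) refl, of n y]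
      by (simp add: D err_def linear_add[OF linear_neumann] linear_scale[OF linear_neumann]
          algebra_simps)
    then show ?thesis by (simp add: inner_add_right x)
  qed
  ultimately show ?thesis
    using LIMSEQ_unique[OF tendsto_resolvent_form[of x "R y"]] by simp
qed

end

locale positive_contraction = linear_contraction +
  assumes symmetric: "A x \<bullet> y = x \<bullet> A y" and nonneg: "0 \<le> A x \<bullet> x"
begin

text \<open>Symmetry moves one factor \<open>A\<close> to the left, so the exponent drops by two and
  only exponents 0 and 1 remain.\<close>

lemma inner_funpow_nonneg: "0 \<le> x \<bullet> (A ^^ n) x"
proof (induction n arbitrary: x rule: induct_nat_012)
  case (ge2 n)
  have "x \<bullet> (A ^^ Suc (Suc n)) x = A x \<bullet> (A ^^ n) (A x)"
    by (simp add: symmetric funpow_swap1)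
  then show ?case using ge2(1)[of "A x"] by simp
next
  case 1
  then show ?case using nonneg[of x] by (simp add: inner_commute)
qed simp

text \<open>The Neumann series has nonnegative terms and the left side is the first. This bound
  fixes the signs of the solution of the Dyson equation.\<close>

lemma resolvent_form_ge: "x \<bullet> x \<le> resolvent_form x x"
proof -
  have "(\<Sum>k<1. x \<bullet> (A ^^ k) x) \<le> resolvent_form x x"
    unfolding resolvent_form_def
    by (intro sum_le_suminf summable_inner_funpow) (auto intro: inner_funpow_nonneg)
  then show ?thesis by simp
qed

end


section \<open>The Dyson equation\<close>

definition shift :: "'k \<Rightarrow> 'k fock^'n \<Rightarrow> 'k fock^'n" where
  "shift k \<zeta> = (\<chi> i. create_right k (\<zeta> $ i))"

definition vec_parity :: "'k fock^'n \<Rightarrow> 'k fock^'n" where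
  "vec_parity \<zeta> = (\<chi> i. parity (\<zeta> $ i))"

abbreviation site :: "'n \<Rightarrow> 'k fock^'n" where
  "site i \<equiv> axis i vac"

lemma linear_shift: "linear (shift k)"
  by (intro linearI)
    (simp_all add: shift_def vec_eq_iff linear_add[OF linear_create_right]
      linear_scale[OF linear_create_right])

lemma linear_vec_parity: "linear vec_parity"
  by (intro linearI)
    (simp_all add: vec_parity_def vec_eq_iff linear_add[OF linear_parity] linear_scale[OF linear_parity])

lemma norm_shift [simp]: "norm (shift k \<zeta>) = norm \<zeta>"
  by (simp add: shift_def norm_vec_def)

lemma inner_vec_parity: "vec_parity \<zeta> \<bullet> vec_parity \<theta> = \<zeta> \<bullet> \<theta>"
  by (simp add: vec_parity_def inner_vec_def inner_parity)

lemma inner_site: "site i \<bullet> \<zeta> = coeff (\<zeta> $ i) []"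
  by (simp add: inner_axis' inner_ket)

lemma inner_site_site: "site i \<bullet> site i = 1"
  unfolding inner_site by (simp add: axis_def)

lemma inner_site_shift: "site i \<bullet> shift k \<zeta> = 0"
  by (simp add: inner_site shift_def coeff_create_right)

lemma noise_shift:
  "noise \<sigma> (shift (i, j) \<eta>) = shift (i, j) (noise \<sigma> \<eta>) + (\<sigma> $ i $ j * (site j \<bullet> \<eta>)) *\<^sub>R site i"
proof -
  have "(\<Sum>j'\<in>UNIV. \<sigma> $ l $ j' *\<^sub>R gauss (l, j') (create_right (i, j) (\<eta> $ j'))) =
      create_right (i, j) (\<Sum>j'\<in>UNIV. \<sigma> $ l $ j' *\<^sub>R gauss (l, j') (\<eta> $ j')) +
      (\<sigma> $ i $ j * coeff (\<eta> $ j) []) *\<^sub>R site i $ l" for l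
  proof -
    have "(\<Sum>j'\<in>UNIV. (\<sigma> $ l $ j' * (if (l, j') = (i, j) then coeff (\<eta> $ j') [] else 0)) *\<^sub>R vac)
        = (\<Sum>j'\<in>UNIV. if j' = j then (if l = i then \<sigma> $ i $ j * coeff (\<eta> $ j) [] else 0) *\<^sub>R vac else 0)"
      by (rule sum.cong) auto
    also have "\<dots> = (\<sigma> $ i $ j * coeff (\<eta> $ j) []) *\<^sub>R site i $ l"
      by (simp add: axis_def)
    finally have eq: "(\<Sum>j'\<in>UNIV. (\<sigma> $ l $ j' * (if (l, j') = (i, j) then coeff (\<eta> $ j') [] else 0)) *\<^sub>R vac)
        = (\<sigma> $ i $ j * coeff (\<eta> $ j) []) *\<^sub>R site i $ l" .
    show ?thesis
      unfolding gauss_create_right scaleR_add_right scaleR_scaleR sum.distrib eq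
        linear_sum[OF linear_create_right] linear_scale[OF linear_create_right] ..
  qed
  then show ?thesis by (simp add: vec_eq_iff noise_def shift_def inner_site)
qed

lemma noise_adj_shift:
  "noise_adj \<sigma> (shift (i, j) \<zeta>) =
    shift (i, j) (noise_adj \<sigma> \<zeta>) + (\<sigma> $ i $ j * (site i \<bullet> \<zeta>)) *\<^sub>R site j"
proof -
  have "(\<Sum>i'\<in>UNIV. \<sigma> $ i' $ l *\<^sub>R gauss (i', l) (create_right (i, j) (\<zeta> $ i'))) =
      create_right (i, j) (\<Sum>i'\<in>UNIV. \<sigma> $ i' $ l *\<^sub>R gauss (i', l) (\<zeta> $ i')) +
      (\<sigma> $ i $ j * coeff (\<zeta> $ i) []) *\<^sub>R site j $ l" for l
  proof -
    have "(\<Sum>i'\<in>UNIV. (\<sigma> $ i' $ l * (if (i', l) = (i, j) then coeff (\<zeta> $ i') [] else 0)) *\<^sub>R vac)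
        = (\<Sum>i'\<in>UNIV. if i' = i then (if l = j then \<sigma> $ i $ j * coeff (\<zeta> $ i) [] else 0) *\<^sub>R vac else 0)"
      by (rule sum.cong) auto
    also have "\<dots> = (\<sigma> $ i $ j * coeff (\<zeta> $ i) []) *\<^sub>R site j $ l"
      by (simp add: axis_def)
    finally have eq: "(\<Sum>i'\<in>UNIV. (\<sigma> $ i' $ l * (if (i', l) = (i, j) then coeff (\<zeta> $ i') [] else 0)) *\<^sub>R vac)
        = (\<sigma> $ i $ j * coeff (\<zeta> $ i) []) *\<^sub>R site j $ l" .
    show ?thesis
      unfolding gauss_create_right scaleR_add_right scaleR_scaleR sum.distrib eq
        linear_sum[OF linear_create_right] linear_scale[OF linear_create_right] ..
  qed
  then show ?thesis by (simp add: vec_eq_iff noise_adj_def shift_def inner_site)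
qed

text \<open>The corrections from \<open>noise_adj_shift\<close> and \<open>noise_shift\<close>
  combine to a symmetric commutator of rank at most two, built from \<open>site i\<close> and
  \<open>noise \<sigma> (site j)\<close>; this is the shape that
  \<open>resolvent_form_commutator\<close> takes.\<close>

lemma model_shift:
  "model \<sigma> b (shift (i, j) \<zeta>) = shift (i, j) (model \<sigma> b \<zeta>) +
    \<sigma> $ i $ j *\<^sub>R ((noise \<sigma> (site j) \<bullet> \<zeta>) *\<^sub>R site i + (site i \<bullet> \<zeta>) *\<^sub>R noise \<sigma> (site j))"
proof -
  have "(\<chi> l. b $ l *\<^sub>R shift (i, j) \<zeta> $ l) = shift (i, j) (\<chi> l. b $ l *\<^sub>R \<zeta> $ l)"
    by (simp add: shift_def vec_eq_iff linear_scale[OF linear_create_right])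
  then show ?thesis
    by (simp add: model_def noise_adj_shift linear_add[OF linear_noise] linear_scale[OF linear_noise]
        noise_shift inner_noise linear_add[OF linear_shift] scaleR_add_right)
qed

lemma inner_noise_site_shift:
  "noise \<sigma> (site j) \<bullet> shift (i, j) \<zeta> = \<sigma> $ i $ j * (site i \<bullet> \<zeta>)"
  by (simp add: inner_noise noise_adj_shift inner_add_right inner_site_shift inner_site_site)

text \<open>Rewriting the first step away from the vacuum by right creation makes the commutator
  formula applicable to it.\<close>

lemma noise_site: "noise \<sigma> (site j) = (\<Sum>i\<in>UNIV. \<sigma> $ i $ j *\<^sub>R shift (i, j) (site i))"
proof -
  have "(\<Sum>j'\<in>UNIV. \<sigma> $ l $ j' *\<^sub>R gauss (l, j') (site j $ j')) =
      (\<Sum>i\<in>UNIV. \<sigma> $ i $ j *\<^sub>R create_right (i, j) (site i $ l))" for l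
  proof -
    have "(\<Sum>j'\<in>UNIV. \<sigma> $ l $ j' *\<^sub>R gauss (l, j') (site j $ j')) =
        (\<Sum>j'\<in>UNIV. if j' = j then \<sigma> $ l $ j *\<^sub>R gauss (l, j) vac else 0)"
      by (rule sum.cong) (auto simp: axis_def linear_0[OF linear_gauss])
    moreover have "(\<Sum>i\<in>UNIV. \<sigma> $ i $ j *\<^sub>R create_right (i, j) (site i $ l)) =
        (\<Sum>i\<in>UNIV. if i = l then \<sigma> $ l $ j *\<^sub>R create_right (l, j) vac else 0)"
      by (rule sum.cong) (auto simp: axis_def linear_0[OF linear_create_right])
    ultimately show ?thesis by (simp add: gauss_vac)
  qed
  then show ?thesis by (simp add: vec_eq_iff noise_def shift_def)
qed

lemma noise_adj_site: "noise_adj \<sigma> (site i) = (\<Sum>j\<in>UNIV. \<sigma> $ i $ j *\<^sub>R shift (i, j) (site j))"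
proof -
  have "(\<Sum>i'\<in>UNIV. \<sigma> $ i' $ l *\<^sub>R gauss (i', l) (site i $ i')) =
      (\<Sum>j\<in>UNIV. \<sigma> $ i $ j *\<^sub>R create_right (i, j) (site j $ l))" for l
  proof -
    have "(\<Sum>i'\<in>UNIV. \<sigma> $ i' $ l *\<^sub>R gauss (i', l) (site i $ i')) =
        (\<Sum>i'\<in>UNIV. if i' = i then \<sigma> $ i $ l *\<^sub>R gauss (i, l) vac else 0)"
      by (rule sum.cong) (auto simp: axis_def linear_0[OF linear_gauss])
    moreover have "(\<Sum>j\<in>UNIV. \<sigma> $ i $ j *\<^sub>R create_right (i, j) (site j $ l)) =
        (\<Sum>j\<in>UNIV. if j = l then \<sigma> $ i $ l *\<^sub>R create_right (i, l) vac else 0)"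
      by (rule sum.cong) (auto simp: axis_def linear_0[OF linear_create_right])
    ultimately show ?thesis by (simp add: gauss_vac)
  qed
  then show ?thesis by (simp add: vec_eq_iff noise_adj_def shift_def)
qed

lemma model_site:
  "model \<sigma> b (site i) = b $ i *\<^sub>R site i +
    (\<Sum>j\<in>UNIV. \<sigma> $ i $ j *\<^sub>R (shift (i, j) (noise \<sigma> (site j)) + \<sigma> $ i $ j *\<^sub>R site i))"
proof -
  have "(\<chi> l. b $ l *\<^sub>R site i $ l) = b $ i *\<^sub>R site i"
    by (simp add: vec_eq_iff axis_def)
  then show ?thesis
    by (simp add: model_def noise_adj_site linear_sum[OF linear_noise] linear_scale[OF linear_noise]
        noise_shift inner_site_site)
qed

lemma vec_parity_noise: "vec_parity (noise \<sigma> \<eta>) = - noise \<sigma> (vec_parity \<eta>)"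
  by (simp add: vec_eq_iff vec_parity_def noise_def linear_sum[OF linear_parity]
      linear_scale[OF linear_parity] parity_gauss sum_negf)

lemma vec_parity_noise_adj: "vec_parity (noise_adj \<sigma> \<zeta>) = - noise_adj \<sigma> (vec_parity \<zeta>)"
  by (simp add: vec_eq_iff vec_parity_def noise_adj_def linear_sum[OF linear_parity]
      linear_scale[OF linear_parity] parity_gauss sum_negf)

lemma vec_parity_model: "vec_parity (model \<sigma> b \<zeta>) = model \<sigma> b (vec_parity \<zeta>)"
proof -
  have "vec_parity (\<chi> l. b $ l *\<^sub>R \<zeta> $ l) = (\<chi> l. b $ l *\<^sub>R vec_parity \<zeta> $ l)"
    by (simp add: vec_eq_iff vec_parity_def linear_scale[OF linear_parity])
  then show ?thesis
    by (simp add: model_def linear_add[OF linear_vec_parity] vec_parity_noise vec_parity_noise_adj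
        linear_neg[OF linear_noise])
qed

lemma vec_parity_site: "vec_parity (site i) = site i"
  unfolding vec_eq_iff vec_parity_def
  by (auto simp: axis_def linear_0[OF linear_parity] intro!: fock_eqI)

text \<open>Since \<open>1 - A\<close> is \<open>(z - model) / (z - t)\<close>, the Neumann series
  of \<open>A\<close> yields the resolvent of the model at \<open>z\<close>. The solution consists
  of its diagonal coefficients: \<open>g i\<close> at \<open>site i\<close> and
  \<open>\<kappa> j\<close> at \<open>noise \<sigma> (site j)\<close>. Expanding one argument by
  right shifts and commuting these with the resolvent closes the system.\<close>

lemma dyson_equations:
  fixes \<sigma> :: "real^'m^'d" and b :: "real^'d" and z t \<rho> :: real
  defines "A \<equiv> \<lambda>\<zeta>. (1 / (z - t)) *\<^sub>R (model \<sigma> b \<zeta> - t *\<^sub>R \<zeta>)"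
  assumes A: "positive_contraction A \<rho>" and zt: "z \<noteq> t"
  obtains g \<kappa> where
    "\<And>i. z * g i = 1 + b $ i * g i + (\<Sum>j\<in>UNIV. (\<sigma> $ i $ j)\<^sup>2 * (g i * (1 + \<kappa> j)))"
    "\<And>j. \<kappa> j = (\<Sum>i\<in>UNIV. (\<sigma> $ i $ j)\<^sup>2 * (g i * (1 + \<kappa> j)))"
    "\<And>i. 1 \<le> (z - t) * g i" "\<And>j. 0 \<le> (z - t) * \<kappa> j"
proof -
  interpret positive_contraction A \<rho> by (rule A)
  let ?a = "site :: 'd \<Rightarrow> ('d \<times> 'm) fock^'d" and ?c = "\<lambda>j. noise \<sigma> (site j)"
  \<comment> \<open>The matrix coefficient of (z - model)^-1.\<close>
  define K where "K x y = resolvent_form x y / (z - t)" for x y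
  define g where "g i = K (?a i) (?a i)" for i
  define \<kappa> where "\<kappa> j = K (?c j) (?c j)" for j
  have K_add: "K x (y + y') = K x y + K x y'" for x y y'
    by (simp add: K_def resolvent_form_add add_divide_distrib)
  have K_scaleR: "K x (r *\<^sub>R y) = r * K x y" for x y r
    by (simp add: K_def resolvent_form_scaleR)
  have K_sum: "K x (\<Sum>j\<in>I. f j) = (\<Sum>j\<in>I. K x (f j))" for x I and f :: "'z \<Rightarrow> _"
    by (simp add: K_def resolvent_form_sum sum_divide_distrib)
  have K_step: "z * K x y = x \<bullet> y + K x (model \<sigma> b y)" for x y
  proof -
    have "(z - t) * K x y = x \<bullet> y + K x ((z - t) *\<^sub>R A y)"
      using zt resolvent_form_step[of x y] unfolding K_scaleR by (simp add: K_def)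
    also have "(z - t) *\<^sub>R A y = model \<sigma> b y + (- t) *\<^sub>R y" using zt by (simp add: A_def)
    finally show ?thesis unfolding K_add K_scaleR by (simp add: algebra_simps)
  qed
  have A_shift: "A (shift (i, j) y) - shift (i, j) (A y) =
      (\<sigma> $ i $ j / (z - t)) *\<^sub>R ((?c j \<bullet> y) *\<^sub>R ?a i + (?a i \<bullet> y) *\<^sub>R ?c j)" for i j y
    by (simp add: A_def model_shift linear_scale[OF linear_shift] linear_diff[OF linear_shift]
        flip: scaleR_diff_right)
  have K_shift: "K x (shift (i, j) y) = \<mu> * K (?a i) y +
      \<sigma> $ i $ j * (K (?c j) y * K x (?a i) + K (?a i) y * K x (?c j))"
    if "\<And>y. x \<bullet> shift (i, j) y = \<mu> * (?a i \<bullet> y)" for x i j y \<mu>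
    using resolvent_form_commutator[OF linear_shift norm_shift A_shift that, of y]
    by (simp add: K_def add_divide_distrib distrib_left)
  \<comment> \<open>The model is even, \<open>site i\<close> is even and
    \<open>noise \<sigma> (site j)\<close> is odd, so all mixed coefficients \<open>K_ac\<close> and
    \<open>K_ca\<close> vanish and only \<open>g\<close> and \<open>\<kappa>\<close> survive in the
    commutator formula.\<close>
  have A_parity: "vec_parity ((A ^^ n) y) = (A ^^ n) (vec_parity y)" for n y
  proof (induction n)
    case (Suc n)
    then show ?case
      by (simp add: A_def linear_scale[OF linear_vec_parity] linear_diff[OF linear_vec_parity]
          vec_parity_model)
  qed simp
  have c_parity: "vec_parity (?c j) = - ?c j" for j
    by (simp add: vec_parity_noise vec_parity_site)
  have ac: "?a i \<bullet> (A ^^ n) (?c j) = 0" and ca: "?c j \<bullet> (A ^^ n) (?a i) = 0" for i j n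
    using inner_vec_parity[of "?a i" "(A ^^ n) (?c j)"] inner_vec_parity[of "?c j" "(A ^^ n) (?a i)"]
    by (simp_all add: A_parity c_parity vec_parity_site linear_neg[OF linear_funpow])
  have K_ac: "K (?a i) (?c j) = 0" and K_ca: "K (?c j) (?a i) = 0" for i j
    by (simp_all add: K_def resolvent_form_def ac ca)
  have 1: "K (?a i) (shift (i, j) (?c j)) = \<sigma> $ i $ j * (\<kappa> j * g i)" for i j
    using K_shift[of "?a i" i j 0 "?c j"] by (simp add: inner_site_shift K_ac g_def \<kappa>_def)
  have 2: "K (?c j) (shift (i, j) (?a i)) = \<sigma> $ i $ j * (g i * (1 + \<kappa> j))" for i j
    using K_shift[of "?c j" i j "\<sigma> $ i $ j" "?a i"]
    by (simp add: inner_noise_site_shift K_ca g_def \<kappa>_def algebra_simps)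
  show thesis
  proof
    show "z * g i = 1 + b $ i * g i + (\<Sum>j\<in>UNIV. (\<sigma> $ i $ j)\<^sup>2 * (g i * (1 + \<kappa> j)))" for i
    proof -
      have "z * g i = 1 + K (?a i) (model \<sigma> b (?a i))"
        unfolding g_def K_step by (simp add: inner_site_site)
      then show ?thesis
        unfolding model_site K_add K_scaleR K_sum 1 g_def[symmetric]
        by (simp add: power2_eq_square algebra_simps sum.distrib)
    qed
    show "\<kappa> j = (\<Sum>i\<in>UNIV. (\<sigma> $ i $ j)\<^sup>2 * (g i * (1 + \<kappa> j)))" for j
    proof -
      \<comment> \<open>Only the right argument is expanded; the left one stays as the vector on
        which the adjoint shift is known.\<close>
      have "\<kappa> j = K (?c j) (\<Sum>i\<in>UNIV. \<sigma> $ i $ j *\<^sub>R shift (i, j) (?a i))"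
        unfolding \<kappa>_def by (subst (2) noise_site) (rule refl)
      then show ?thesis unfolding K_sum K_scaleR 2 by (simp add: power2_eq_square mult.assoc)
    qed
    show "1 \<le> (z - t) * g i" for i
      using resolvent_form_ge[of "?a i"] zt by (simp add: g_def K_def inner_site_site)
    show "0 \<le> (z - t) * \<kappa> j" for j
      using order_trans[OF inner_ge_zero resolvent_form_ge[of "?c j"]] zt by (simp add: \<kappa>_def K_def)
  qed
qed

text \<open>Eliminates \<open>\<kappa>\<close>: the second equation makes
  \<open>1 + \<kappa> j\<close> the inverse of
  \<open>1 - (\<Sum>k\<in>UNIV. (\<sigma> $ k $ j)\<^sup>2 * g k)\<close>, and the first one,
  divided by \<open>g i\<close>, is then the statement about \<open>objective\<close>.\<close>

lemma objective_of_dyson: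
  fixes \<sigma> :: "real^'m^'d" and b :: "real^'d"
  assumes 1: "\<And>i. z * g i = 1 + b $ i * g i + (\<Sum>j\<in>UNIV. (\<sigma> $ i $ j)\<^sup>2 * (g i * (1 + \<kappa> j)))"
    and 2: "\<And>j. \<kappa> j = (\<Sum>i\<in>UNIV. (\<sigma> $ i $ j)\<^sup>2 * (g i * (1 + \<kappa> j)))"
    and g: "\<And>i. g i \<noteq> 0"
  shows "(1 + \<kappa> j) * (1 - (\<Sum>k\<in>UNIV. (\<sigma> $ k $ j)\<^sup>2 * g k)) = 1"
    and "objective \<sigma> b (\<chi> i. g i) = z *\<^sub>R 1"
proof -
  have H: "(1 + \<kappa> j) * (1 - (\<Sum>k\<in>UNIV. (\<sigma> $ k $ j)\<^sup>2 * g k)) = 1" for j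
  proof -
    have "(\<Sum>k\<in>UNIV. (\<sigma> $ k $ j)\<^sup>2 * g k) * (1 + \<kappa> j) = \<kappa> j"
      using 2[of j] by (simp add: sum_distrib_right mult.assoc)
    then show ?thesis by (simp add: algebra_simps)
  qed
  then show "(1 + \<kappa> j) * (1 - (\<Sum>k\<in>UNIV. (\<sigma> $ k $ j)\<^sup>2 * g k)) = 1" .
  have h: "1 / (1 - (\<Sum>k\<in>UNIV. (\<sigma> $ k $ j)\<^sup>2 * g k)) = 1 + \<kappa> j" for j
  proof -
    have "1 - (\<Sum>k\<in>UNIV. (\<sigma> $ k $ j)\<^sup>2 * g k) \<noteq> 0" using H[of j] by (metis mult_zero_right zero_neq_one)
    then show ?thesis using H[of j] by (simp add: nonzero_divide_eq_eq)
  qed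
  have "z = b $ i + 1 / g i + (\<Sum>j\<in>UNIV. (\<sigma> $ i $ j)\<^sup>2 * (1 + \<kappa> j))" for i
  proof -
    have "z * g i = (b $ i + 1 / g i + (\<Sum>j\<in>UNIV. (\<sigma> $ i $ j)\<^sup>2 * (1 + \<kappa> j))) * g i"
    proof -
      have "(\<Sum>j\<in>UNIV. (\<sigma> $ i $ j)\<^sup>2 * (1 + \<kappa> j)) * g i = (\<Sum>j\<in>UNIV. (\<sigma> $ i $ j)\<^sup>2 * (g i * (1 + \<kappa> j)))"
        unfolding sum_distrib_right by (intro sum.cong refl) (simp only: mult_ac)
      then show ?thesis unfolding 1 using g[of i] by (simp only: distrib_right) simp
    qed
    then show ?thesis using g[of i] by simp
  qed
  then show "objective \<sigma> b (\<chi> i. g i) = z *\<^sub>R 1"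
    unfolding vec_eq_iff objective_def
    by (simp add: divide_inverse flip: h)
qed

text \<open>Rescaling about the lower bound \<beta> puts the form of \<open>?A\<close> between 0 and
  \<open>(\<alpha> - \<beta>) / (z - \<beta>)\<close>, which is below 1. As
  \<open>z - \<beta>\<close> is positive, \<open>g\<close> is positive and \<open>\<kappa>\<close>
  nonnegative; the latter yields the column constraint.\<close>

lemma equalizing_above:
  fixes \<sigma> :: "real^'m^'d" and b :: "real^'d"
  assumes lo: "\<And>\<zeta>. \<beta> * (\<zeta> \<bullet> \<zeta>) \<le> model \<sigma> b \<zeta> \<bullet> \<zeta>"
    and hi: "\<And>\<zeta>. model \<sigma> b \<zeta> \<bullet> \<zeta> \<le> \<alpha> * (\<zeta> \<bullet> \<zeta>)" and z: "\<alpha> < z"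
  shows "\<exists>v\<in>feasible_max \<sigma>. objective \<sigma> b v = z *\<^sub>R 1"
proof -
  have "\<beta> \<le> \<alpha>"
    using order_trans[OF lo hi, of "site undefined"] by (simp add: inner_site_site)
  then have z\<beta>: "\<beta> < z" using z by simp
  let ?A = "\<lambda>\<zeta>. (1 / (z - \<beta>)) *\<^sub>R (model \<sigma> b \<zeta> - \<beta> *\<^sub>R \<zeta>)"
  have lin: "linear ?A"
    by (intro linear_compose_scale_right linear_compose_sub linear_model linear_scale_self)
  have sym: "?A x \<bullet> y = x \<bullet> ?A y" for x y
    by (simp add: inner_diff_left inner_diff_right inner_model)
  have pos: "0 \<le> ?A x \<bullet> x" for x
    using lo[of x] z\<beta> by (simp add: inner_diff_left)
  have le: "?A x \<bullet> x \<le> (\<alpha> - \<beta>) / (z - \<beta>) * (x \<bullet> x)" for x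
    using hi[of x] z\<beta> by (simp add: inner_diff_left divide_right_mono left_diff_distrib)
  have "positive_contraction ?A ((\<alpha> - \<beta>) / (z - \<beta>))"
    by (intro positive_contraction.intro linear_contraction.intro positive_contraction_axioms.intro
        norm_le_of_form_bounds(2)[OF lin sym pos le] lin sym pos)
      (use \<open>\<beta> \<le> \<alpha>\<close> z z\<beta> in auto)
  from dyson_equations[OF this] z\<beta> obtain g \<kappa> where
    1: "\<And>i. z * g i = 1 + b $ i * g i + (\<Sum>j\<in>UNIV. (\<sigma> $ i $ j)\<^sup>2 * (g i * (1 + \<kappa> j)))" and
    2: "\<And>j. \<kappa> j = (\<Sum>i\<in>UNIV. (\<sigma> $ i $ j)\<^sup>2 * (g i * (1 + \<kappa> j)))" and
    3: "\<And>i. 1 \<le> (z - \<beta>) * g i" "\<And>j. 0 \<le> (z - \<beta>) * \<kappa> j"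
    by auto
  have g: "0 < g i" for i
    using 3(1)[of i] z\<beta> by (metis diff_gt_0_iff_gt less_le_trans zero_less_mult_pos zero_less_one)
  have "0 \<le> \<kappa> j" for j using 3(2)[of j] z\<beta> by (simp add: zero_le_mult_iff)
  note dy = objective_of_dyson[OF 1 2 less_imp_neq[OF g, symmetric]]
  have "(\<Sum>k\<in>UNIV. (\<sigma> $ k $ j)\<^sup>2 * g k) < 1" for j
  proof -
    have "0 < 1 + \<kappa> j" using \<open>0 \<le> \<kappa> j\<close> by simp
    then have "0 < 1 - (\<Sum>k\<in>UNIV. (\<sigma> $ k $ j)\<^sup>2 * g k)"
      using dy(1)[of j] by (metis zero_less_mult_pos zero_less_one)
    then show ?thesis by simp
  qed
  then have "(\<chi> i. g i) \<in> feasible_max \<sigma>"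
    using g by (simp add: feasible_max_def)
  then show ?thesis using dy(2) by blast
qed

text \<open>Now the rescaling is about the upper bound \<alpha>. The factor
  \<open>z - \<alpha>\<close> is negative, so \<open>?A\<close> is again positive while the lower
  bound on \<open>(z - \<alpha>) * g i\<close> makes \<open>g i\<close> negative.\<close>

lemma equalizing_below:
  fixes \<sigma> :: "real^'m^'d" and b :: "real^'d"
  assumes lo: "\<And>\<zeta>. \<beta> * (\<zeta> \<bullet> \<zeta>) \<le> model \<sigma> b \<zeta> \<bullet> \<zeta>"
    and hi: "\<And>\<zeta>. model \<sigma> b \<zeta> \<bullet> \<zeta> \<le> \<alpha> * (\<zeta> \<bullet> \<zeta>)" and z: "z < \<beta>"
  shows "\<exists>v\<in>feasible_min. objective \<sigma> b v = z *\<^sub>R 1"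
proof -
  have "\<beta> \<le> \<alpha>"
    using order_trans[OF lo hi, of "site undefined"] by (simp add: inner_site_site)
  then have z\<alpha>: "z < \<alpha>" using z by simp
  let ?A = "\<lambda>\<zeta>. (1 / (z - \<alpha>)) *\<^sub>R (model \<sigma> b \<zeta> - \<alpha> *\<^sub>R \<zeta>)"
  have lin: "linear ?A"
    by (intro linear_compose_scale_right linear_compose_sub linear_model linear_scale_self)
  have sym: "?A x \<bullet> y = x \<bullet> ?A y" for x y
    by (simp add: inner_diff_left inner_diff_right inner_model)
  have form: "?A x \<bullet> x = (\<alpha> * (x \<bullet> x) - model \<sigma> b x \<bullet> x) / (\<alpha> - z)" for x
    by (simp add: inner_diff_left) (metis minus_diff_eq minus_divide_divide)
  have pos: "0 \<le> ?A x \<bullet> x" for x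
    unfolding form using hi[of x] z\<alpha> by simp
  have le: "?A x \<bullet> x \<le> (\<alpha> - \<beta>) / (\<alpha> - z) * (x \<bullet> x)" for x
    unfolding form using lo[of x] z\<alpha> by (simp add: divide_right_mono left_diff_distrib)
  have "positive_contraction ?A ((\<alpha> - \<beta>) / (\<alpha> - z))"
    by (intro positive_contraction.intro linear_contraction.intro positive_contraction_axioms.intro
        norm_le_of_form_bounds(2)[OF lin sym pos le] lin sym pos)
      (use \<open>\<beta> \<le> \<alpha>\<close> z z\<alpha> in auto)
  from dyson_equations[OF this less_imp_neq[OF z\<alpha>]] obtain g \<kappa> where
    1: "\<And>i. z * g i = 1 + b $ i * g i + (\<Sum>j\<in>UNIV. (\<sigma> $ i $ j)\<^sup>2 * (g i * (1 + \<kappa> j)))" and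
    2: "\<And>j. \<kappa> j = (\<Sum>i\<in>UNIV. (\<sigma> $ i $ j)\<^sup>2 * (g i * (1 + \<kappa> j)))" and
    3: "\<And>i. 1 \<le> (z - \<alpha>) * g i" and "\<And>j. 0 \<le> (z - \<alpha>) * \<kappa> j"
    by blast
  have g: "g i < 0" for i
    using less_le_trans[OF zero_less_one 3(1)[of i]] z\<alpha> by (simp add: zero_less_mult_iff)
  then have "(\<chi> i. g i) \<in> feasible_min"
    by (simp add: feasible_min_def)
  then show ?thesis using objective_of_dyson(2)[OF 1 2 less_imp_neq[OF g]] by blast
qed


section \<open>Chebyshev polynomials and the semicircle law\<close>

text \<open>The Chebyshev polynomials of the second kind, rescaled to \<open>[-2, 2]\<close>.\<close>

fun cheb :: "nat \<Rightarrow> 'a::ring_1 \<Rightarrow> 'a" where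
  "cheb 0 x = 1"
| "cheb (Suc 0) x = x"
| "cheb (Suc (Suc n)) x = x * cheb (Suc n) x - cheb n x"

text \<open>Explicit coefficients reduce the expectation of \<open>cheb n\<close> to the moments,
  which are all that the semicircular law prescribes.\<close>

fun cheb_coeff :: "nat \<Rightarrow> nat \<Rightarrow> real" where
  "cheb_coeff 0 i = (if i = 0 then 1 else 0)"
| "cheb_coeff (Suc 0) i = (if i = 1 then 1 else 0)"
| "cheb_coeff (Suc (Suc n)) i =
    (case i of 0 \<Rightarrow> 0 | Suc j \<Rightarrow> cheb_coeff (Suc n) j) - cheb_coeff n i"

lemma cheb_coeff_eq_0: "n < i \<Longrightarrow> cheb_coeff n i = 0"
  by (induction n i rule: cheb_coeff.induct) (auto split: nat.splits)

lemma cheb_eq_sum: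
  fixes x :: "'a::real_algebra_1"
  shows "cheb n x = (\<Sum>i\<le>n. cheb_coeff n i *\<^sub>R x ^ i)"
proof (induction n x rule: cheb.induct)
  case (3 n x)
  have "(\<Sum>i\<le>Suc (Suc n). (case i of 0 \<Rightarrow> 0 | Suc j \<Rightarrow> cheb_coeff (Suc n) j) *\<^sub>R x ^ i) =
      x * (\<Sum>i\<le>Suc n. cheb_coeff (Suc n) i *\<^sub>R x ^ i)"
    by (subst sum.atMost_Suc_shift) (simp add: sum_distrib_left distrib_left)
  moreover have "(\<Sum>i\<le>Suc (Suc n). cheb_coeff n i *\<^sub>R x ^ i) = (\<Sum>i\<le>n. cheb_coeff n i *\<^sub>R x ^ i)"
    by (simp add: cheb_coeff_eq_0)
  ultimately show ?case
    by (simp only: cheb.simps cheb_coeff.simps 3 scaleR_diff_left sum_subtractf)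
qed simp_all

lemma sin_cheb: "sin \<theta> * cheb n (2 * cos \<theta>) = sin (real (Suc n) * \<theta>)"
proof (induction n rule: induct_nat_012)
  case 1
  show ?case using sin_double[of \<theta>] by (simp add: algebra_simps)
next
  case (ge2 n)
  have "sin (real (Suc (Suc (Suc n))) * \<theta>) + sin (real (Suc n) * \<theta>) =
      2 * cos \<theta> * sin (real (Suc (Suc n)) * \<theta>)"
    by (simp add: sin_plus_sin algebra_simps diff_divide_distrib add_divide_distrib)
  then show ?case using ge2 by (simp add: algebra_simps)
qed simp

lemma continuous_on_cheb: "continuous_on S (cheb n :: real \<Rightarrow> real)"
proof -
  have "cheb n = (\<lambda>x::real. \<Sum>i\<le>n. cheb_coeff n i *\<^sub>R x ^ i)"
    by (rule ext) (rule cheb_eq_sum)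
  then show ?thesis by (simp add: continuous_intros)
qed

text \<open>Orthogonality of \<open>cheb n\<close> and \<open>cheb 0\<close> for the semicircle
  weight.\<close>

lemma has_integral_cheb:
  assumes n: "0 < n"
  shows "((\<lambda>t. cheb n t * sqrt (4 - t\<^sup>2)) has_integral 0) {-2..2::real}"
proof -
  \<comment> \<open>With t = 2 cos \<theta> the integrand becomes -4 sin ((n + 1) \<theta>) sin
    \<theta> = -2 (cos (n \<theta>) - cos ((n + 2) \<theta>)), whose antiderivative this is; it
    vanishes for \<theta> = 0 and \<theta> = \<pi>.\<close>
  define F where "F t = - 2 * (sin (real n * arccos (t / 2)) / real n -
      sin (real (n + 2) * arccos (t / 2)) / real (n + 2))" for t
  have "((\<lambda>t. cheb n t * sqrt (4 - t\<^sup>2)) has_integral (F 2 - F (-2))) {-2..2::real}"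
  \<comment> \<open>The interior version is used because \<open>arccos\<close> has no finite
    derivative at the endpoints.\<close>
  proof (rule fundamental_theorem_of_calculus_interior)
    have "continuous_on {-2..2} (\<lambda>t::real. arccos (t / 2))"
      by (intro continuous_on_arccos continuous_intros) auto
    then show "continuous_on {-2..2} F"
      unfolding F_def using n by (intro continuous_intros) auto
    fix t :: real assume t: "t \<in> {-2<..<2}"
    define \<theta> where "\<theta> = arccos (t / 2)"
    have \<theta>: "0 < \<theta>" "\<theta> < pi" using t arccos_lt_bounded[of "t / 2"] by (auto simp: \<theta>_def)
    then have s: "0 < sin \<theta>" by (rule sin_gt_zero)
    have c: "2 * cos \<theta> = t" using t by (simp add: \<theta>_def)
    have q1: "sqrt (1 - (t / 2)\<^sup>2) = sin \<theta>"
      using t by (simp add: \<theta>_def sin_arccos)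
    have "4 - t\<^sup>2 = 2\<^sup>2 * (1 - (t / 2)\<^sup>2)" by (simp add: power_divide)
    then have q2: "sqrt (4 - t\<^sup>2) = 2 * sin \<theta>" by (simp only: real_sqrt_mult q1) simp
    have "DERIV arccos (t / 2) :> inverse (- sin \<theta>)"
      using DERIV_arccos[of "t / 2"] t by (simp add: q1)
    then have d: "((\<lambda>t. arccos (t / 2)) has_real_derivative (- (1 / (2 * sin \<theta>)))) (at t)"
      by (rule DERIV_chain2[THEN DERIV_cong]) (auto intro!: derivative_eq_intros simp: field_simps)
    have "(F has_real_derivative - 2 * (cos (real n * \<theta>) * (real n * (- (1 / (2 * sin \<theta>)))) / real n -
        cos (real (n + 2) * \<theta>) * (real (n + 2) * (- (1 / (2 * sin \<theta>)))) / real (n + 2))) (at t)"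
      unfolding F_def \<theta>_def
      by (intro DERIV_cmult DERIV_diff DERIV_cdivide DERIV_fun_sin d[unfolded \<theta>_def])
    moreover have "- 2 * (cos (real n * \<theta>) * (real n * (- (1 / (2 * sin \<theta>)))) / real n -
        cos (real (n + 2) * \<theta>) * (real (n + 2) * (- (1 / (2 * sin \<theta>)))) / real (n + 2)) =
        (cos (real n * \<theta>) - cos (real (n + 2) * \<theta>)) / sin \<theta>"
    proof -
      have "x * (real m * y) / real m = x * y" if "0 < m" for x y m using that by simp
      from this[OF n] this[of "n + 2"] show ?thesis
        using s by (simp only: add_gr_0 zero_less_numeral simp_thms) (simp add: field_simps)
    qed
    moreover have "cos (real n * \<theta>) - cos (real (n + 2) * \<theta>) = 2 * sin (real (Suc n) * \<theta>) * sin \<theta>"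
    proof -
      have "real n * \<theta> = real (Suc n) * \<theta> - \<theta>" "real (n + 2) * \<theta> = real (Suc n) * \<theta> + \<theta>"
        by (simp_all add: algebra_simps)
      then show ?thesis by (simp only: cos_diff cos_add)
    qed
    ultimately have "(F has_real_derivative 2 * sin (real (Suc n) * \<theta>)) (at t)"
      using s by simp
    also have "2 * sin (real (Suc n) * \<theta>) = cheb n t * sqrt (4 - t\<^sup>2)"
      unfolding q2 unfolding sin_cheb[of \<theta> n, unfolded c, symmetric] by simp
    finally show "(F has_vector_derivative cheb n t * sqrt (4 - t\<^sup>2)) (at t)"
      by (simp add: has_real_derivative_iff_has_vector_derivative)
  qed simp
  moreover have "F 2 = 0" "F (-2) = 0"
    using sin_npi[of n] sin_npi[of "n + 2"] by (simp_all add: F_def)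
  ultimately show ?thesis by simp
qed

lemma integrable_semicircle:
  assumes "continuous_on UNIV f"
  shows "integrable semicircle_distribution f"
    and "(LINT t|semicircle_distribution. f t) =
      1 / (2 * pi) * integral {-2..2} (\<lambda>t. f t * sqrt (4 - t\<^sup>2))"
proof -
  let ?d = "\<lambda>t::real. indicator {-2..2} t * (1 / (2 * pi) * sqrt (4 - t\<^sup>2))"
  have nonneg: "0 \<le> ?d t" for t
  proof (cases "t \<in> {-2..2}")
    case True
    then have "t\<^sup>2 \<le> 2\<^sup>2" by (intro abs_le_square_iff[THEN iffD1]) auto
    then show ?thesis by simp
  qed simp
  have meas: "f \<in> borel_measurable lborel"
    using assms by (simp add: borel_measurable_continuous_onI)
  have eq: "?d t *\<^sub>R f t = indicator {-2..2} t *\<^sub>R (1 / (2 * pi) * (f t * sqrt (4 - t\<^sup>2)))" for t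
    by (simp add: mult_ac)
  have cont: "continuous_on {-2..2} (\<lambda>t::real. 1 / (2 * pi) * (f t * sqrt (4 - t\<^sup>2)))"
    by (intro continuous_intros continuous_on_subset[OF assms]) auto
  then have int: "set_integrable lborel {-2..2} (\<lambda>t::real. 1 / (2 * pi) * (f t * sqrt (4 - t\<^sup>2)))"
    by (rule borel_integrable_atLeastAtMost')
  then have "integrable lborel (\<lambda>t. ?d t *\<^sub>R f t)"
    unfolding eq set_integrable_def .
  then show "integrable semicircle_distribution f"
    unfolding semicircle_distribution_def using nonneg meas by (subst integrable_density) auto
  have "(LINT t|semicircle_distribution. f t) = (LINT t|lborel. ?d t *\<^sub>R f t)"
    unfolding semicircle_distribution_def using nonneg meas by (subst integral_density) auto
  also have "\<dots> = (LINT t:{-2..2}|lborel. 1 / (2 * pi) * (f t * sqrt (4 - t\<^sup>2)))"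
    unfolding eq set_lebesgue_integral_def ..
  also have "\<dots> = integral {-2..2} (\<lambda>t. 1 / (2 * pi) * (f t * sqrt (4 - t\<^sup>2)))"
    by (rule set_borel_integral_eq_integral(2)[OF int])
  finally show "(LINT t|semicircle_distribution. f t) =
      1 / (2 * pi) * integral {-2..2} (\<lambda>t. f t * sqrt (4 - t\<^sup>2))"
    by (simp only: integral_mult_right)
qed

lemma (in cstar_prob_space) state_cheb:
  assumes "standard_semicircular \<tau> a" "0 < n"
  shows "\<tau> (cheb n a) = 0"
proof -
  have int: "integrable semicircle_distribution (\<lambda>t::real. t ^ i)" for i
    by (intro integrable_semicircle(1) continuous_intros)
  have "\<tau> (cheb n a) = (\<Sum>i\<le>n. cheb_coeff n i *\<^sub>R complex_of_real (LINT t|semicircle_distribution. t ^ i))"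
    using assms(1) unfolding cheb_eq_sum standard_semicircular_def
    by (simp add: state_sum state_scaleR)
  also have "\<dots> = complex_of_real (\<Sum>i\<le>n. cheb_coeff n i * (LINT t|semicircle_distribution. t ^ i))"
    by (simp add: scaleR_conv_of_real)
  also have "(\<Sum>i\<le>n. cheb_coeff n i * (LINT t|semicircle_distribution. t ^ i)) =
      (LINT t|semicircle_distribution. cheb n t)"
    using int unfolding cheb_eq_sum by (simp add: Bochner_Integration.integral_sum)
  also have "\<dots> = 0"
    using integrable_semicircle(2)[OF continuous_on_cheb, of n]
      integral_unique[OF has_integral_cheb[OF assms(2)]]
    by simp
  finally show ?thesis by simp
qed


section \<open>Fock space representation of free semicircular families\<close>

text \<open>The Wick polynomial of a word. The recursion is solved from the requirement that left
  multiplication by \<open>a k\<close> either prepends \<open>k\<close> or, in addition, removes a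
  leading \<open>k\<close>.\<close>

fun chain :: "('k \<Rightarrow> 'a::ring_1) \<Rightarrow> 'k list \<Rightarrow> 'a" where
  "chain a [] = 1"
| "chain a [k] = a k"
| "chain a (k # l # w) = a k * chain a (l # w) - (if l = k then chain a w else 0)"

definition rep :: "('k \<Rightarrow> 'a::real_algebra_1) \<Rightarrow> 'k fock \<Rightarrow> 'a" where
  "rep a f = (\<Sum>w | coeff f w \<noteq> 0. coeff f w *\<^sub>R chain a w)"

lemma rep_eq:
  assumes "finite W" "{w. coeff f w \<noteq> 0} \<subseteq> W"
  shows "rep a f = (\<Sum>w\<in>W. coeff f w *\<^sub>R chain a w)"
  unfolding rep_def by (rule sum.mono_neutral_left) (use assms in auto)

lemma linear_rep:
  fixes a :: "'k \<Rightarrow> 'a::real_algebra_1"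
  shows "linear (rep a)"
proof (rule linearI)
  fix f g :: "'k fock" and r :: real
  let ?W = "{w. coeff f w \<noteq> 0} \<union> {w. coeff g w \<noteq> 0}"
  have W: "finite ?W" by (simp add: finite_supp)
  have "rep a h = (\<Sum>w\<in>?W. coeff h w *\<^sub>R chain a w)" if "h \<in> {f, g, f + g}" for h
    by (rule rep_eq[OF W]) (use that in auto)
  then show "rep a (f + g) = rep a f + rep a g"
    by (simp add: scaleR_add_left sum.distrib)
  have "rep a (r *\<^sub>R f) = (\<Sum>w | coeff f w \<noteq> 0. coeff (r *\<^sub>R f) w *\<^sub>R chain a w)"
    by (rule rep_eq[OF finite_supp]) auto
  then show "rep a (r *\<^sub>R f) = r *\<^sub>R rep a f"
    by (simp add: rep_def scaleR_sum_right)
qed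

lemma rep_ket [simp]: "rep a (ket w) = chain a w"
proof -
  have "{v. coeff (ket w) v \<noteq> 0} = {w}" by auto
  then show ?thesis by (simp add: rep_def)
qed

lemma fock_expansion: "f = (\<Sum>w | coeff f w \<noteq> 0. coeff f w *\<^sub>R ket w)"
proof (rule fock_eqI)
  fix v
  have "(\<Sum>w | coeff f w \<noteq> 0. coeff f w * (if v = w then 1 else 0)) =
      (\<Sum>w | coeff f w \<noteq> 0. if v = w then coeff f w else 0)"
    by (rule sum.cong) auto
  then show "coeff f v = coeff (\<Sum>w | coeff f w \<noteq> 0. coeff f w *\<^sub>R ket w) v"
    by (simp add: finite_supp)
qed

lemma create_ket: "create k (ket w) = ket (k # w)"
  by (intro fock_eqI, case_tac wa) auto

lemma annihilate_ket: "annihilate k (ket w) = (if w \<noteq> [] \<and> hd w = k then ket (tl w) else 0)"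
  by (intro fock_eqI, cases w) auto

text \<open>Purely algebraic: the recursion of \<open>chain\<close> is made so that left
  multiplication becomes creation plus annihilation. Freeness enters with the trace.\<close>

lemma mult_rep: "a k * rep a f = rep a (gauss k f)"
proof -
  have ket: "a k * chain a w = rep a (gauss k (ket w))" for w
    by (cases w) (auto simp: gauss_def create_ket annihilate_ket linear_add[OF linear_rep]
        linear_0[OF linear_rep])
  have "rep a (gauss k f) = rep a (gauss k (\<Sum>w | coeff f w \<noteq> 0. coeff f w *\<^sub>R ket w))"
    by (simp flip: fock_expansion)
  also have "\<dots> = (\<Sum>w | coeff f w \<noteq> 0. coeff f w *\<^sub>R rep a (gauss k (ket w)))"
    by (simp only: linear_sum[OF linear_gauss] linear_scale[OF linear_gauss]
        linear_sum[OF linear_rep] linear_scale[OF linear_rep])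
  also have "\<dots> = a k * rep a f"
    unfolding ket[symmetric] by (simp add: rep_def[of a f] sum_distrib_left)
  finally show ?thesis ..
qed

text \<open>Within a run of equal letters the recursion of \<open>chain\<close> is the Chebyshev
  recursion; at the end of the run the correction term is absent because the next letter
  differs.\<close>

lemma chain_replicate:
  assumes "w = [] \<or> hd w \<noteq> k"
  shows "chain a (replicate n k @ w) = cheb n (a k) * chain a w"
proof (induction n rule: induct_nat_012)
  case 1
  then show ?case using assms by (cases w) auto
next
  case (ge2 n)
  then show ?case by (simp add: algebra_simps)
qed simp

lemma cheb_in_generated: "cheb n a \<in> generated_star_algebra {a}"
proof (induction n a rule: cheb.induct)
  case (3 n x)
  have "scaleC (-1) (cheb n x) \<in> generated_star_algebra {x}"
    by (rule generated_star_algebra.scaleC[OF 3(2)])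
  moreover have "x * cheb (Suc n) x \<in> generated_star_algebra {x}"
    by (intro generated_star_algebra.mult generated_star_algebra.base 3) simp
  ultimately have "x * cheb (Suc n) x + scaleC (-1) (cheb n x) \<in> generated_star_algebra {x}"
    by (intro generated_star_algebra.add)
  then show ?case by (simp add: scaleC_minus_left)
qed (auto intro: generated_star_algebra.intros)

section \<open>The representation is isometric for the trace\<close>

locale semicircular_system = faithful_trace_cstar_prob_space \<tau>
  for \<tau> :: "'a::cstar_algebra \<Rightarrow> complex" +
  fixes a :: "'k \<Rightarrow> 'a"
  assumes free_semicircular: "free_semicircular_family \<tau> a"
begin

lemma semicircular: "standard_semicircular \<tau> (a k)"
  using free_semicircular by (simp add: free_semicircular_family_def)

lemma star_a [simp]: "star (a k) = a k"
  using semicircular[of k] by (simp add: standard_semicircular_def)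

text \<open>A nonempty word is a concatenation of maximal constant runs; each run contributes a centred
  Chebyshev polynomial.\<close>

lemma chain_factorization:
  assumes "w \<noteq> []"
  shows "\<exists>ks cs. ks \<noteq> [] \<and> hd ks = hd w \<and> distinct_adj ks \<and>
    list_all2 (\<lambda>k c. c \<in> generated_star_algebra {a k} \<and> \<tau> c = 0) ks cs \<and>
    chain a w = prod_list cs"
  using assms
proof (induction w rule: length_induct)
  case (1 w)
  define k where "k = hd w"
  define n where "n = length (takeWhile (\<lambda>l. l = k) w)"
  define v where "v = dropWhile (\<lambda>l. l = k) w"
  have run: "takeWhile (\<lambda>l. l = k) w = replicate n k"
    unfolding n_def by (intro replicate_eqI refl) (auto dest: set_takeWhileD)
  have w: "w = replicate n k @ v"
    unfolding v_def run[symmetric] by simp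
  have n: "0 < n" using 1(2) by (cases w) (auto simp: n_def k_def)
  have v: "v = [] \<or> hd v \<noteq> k" using hd_dropWhile[of "\<lambda>l. l = k" w] by (auto simp: v_def)
  have c: "cheb n (a k) \<in> generated_star_algebra {a k} \<and> \<tau> (cheb n (a k)) = 0"
    using cheb_in_generated state_cheb[OF semicircular n] by blast
  have chain: "chain a w = cheb n (a k) * chain a v"
    unfolding w by (rule chain_replicate[OF v])
  show ?case
  proof (cases "v = []")
    case True
    then show ?thesis
      using c chain by (intro exI[of _ "[k]"] exI[of _ "[cheb n (a k)]"]) (simp add: k_def)
  next
    case False
    moreover have "length v < length w" using n by (simp add: w)
    ultimately obtain ks cs where IH: "ks \<noteq> []" "hd ks = hd v" "distinct_adj ks"
      "list_all2 (\<lambda>k c. c \<in> generated_star_algebra {a k} \<and> \<tau> c = 0) ks cs" "chain a v = prod_list cs"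
      using 1(1) by blast
    have "distinct_adj (k # ks)" using IH(1-3) v False by (cases ks) auto
    then show ?thesis using c chain IH
      by (intro exI[of _ "k # ks"] exI[of _ "cheb n (a k) # cs"]) (simp add: k_def)
  qed
qed

lemma state_chain: "\<tau> (chain a w) = (if w = [] then 1 else 0)"
proof (cases "w = []")
  case False
  from chain_factorization[OF this] obtain ks cs where ks: "ks \<noteq> []" "distinct_adj ks"
    "list_all2 (\<lambda>k c. c \<in> generated_star_algebra {a k} \<and> \<tau> c = 0) ks cs" "chain a w = prod_list cs"
    by blast
  have "freely_independent \<tau> a"
    using free_semicircular by (simp add: free_semicircular_family_def)
  then have "\<tau> (prod_list cs) = 0"
    unfolding freely_independent_def using ks(1-3) by blast
  then show ?thesis using False ks(4) by simp
qed (simp add: state_one)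

lemma state_rep: "\<tau> (rep a f) = complex_of_real (coeff f [])"
proof -
  have "\<tau> (rep a f) = (\<Sum>w | coeff f w \<noteq> 0. if w = [] then complex_of_real (coeff f w) else 0)"
    unfolding rep_def state_sum state_scaleR state_chain
    by (intro sum.cong) (auto simp: scaleR_conv_of_real)
  then show ?thesis by (simp add: finite_supp)
qed

text \<open>The first letter \<open>k\<close>, being self-adjoint, passes to the other factor and
  acts there as \<open>gauss k\<close>. The correction term of \<open>chain\<close> cancels its
  creation part, and the annihilation part reads off \<open>coeff g (k # v)\<close>.\<close>

lemma state_chain_rep: "\<tau> (star (chain a w) * rep a g) = complex_of_real (coeff g w)"
proof (induction w arbitrary: g rule: length_induct)
  case (1 w)
  show ?case
  proof (cases w)
    case Nil
    then show ?thesis by (simp add: state_rep)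
  next
    case (Cons k v)
    have "star (a k * chain a v) * rep a g = star (chain a v) * rep a (gauss k g)"
      by (simp add: star_mult mult.assoc mult_rep)
    then have 2: "\<tau> (star (a k * chain a v) * rep a g) = complex_of_real (coeff (gauss k g) v)"
      using 1 Cons by simp
    show ?thesis
    proof (cases v)
      case Nil
      then show ?thesis using 2 Cons by (simp add: gauss_def)
    next
      case (Cons l u)
      then have "\<tau> (star (chain a u) * rep a g) = complex_of_real (coeff g u)"
        using 1 \<open>w = k # v\<close> by simp
      then show ?thesis using 2 Cons \<open>w = k # v\<close>
        by (auto simp: gauss_def star_diff left_diff_distrib state_diff)
    qed
  qed
qed

lemma state_rep_rep: "\<tau> (star (rep a f) * rep a g) = complex_of_real (f \<bullet> g)"
proof -
  have eq: "star (rep a f) * rep a g = (\<Sum>w | coeff f w \<noteq> 0. coeff f w *\<^sub>R (star (chain a w) * rep a g))"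
    by (subst (1) rep_def) (simp add: star_sum star_scaleR sum_distrib_right)
  show ?thesis
    unfolding eq state_sum state_scaleR state_chain_rep inner_fock_def
    by (simp add: scaleR_conv_of_real)
qed

text \<open>Transfers operator bounds on the Fock space to the C*-norm: since 1 is
  \<open>rep a vac\<close>, the moments of \<open>star c * c\<close> are vacuum coefficients of
  powers of \<open>?D\<close>, to which \<open>norm_le_of_moments\<close> applies.\<close>

lemma norm_le_of_rep:
  assumes c: "\<And>f. c * rep a f = rep a (B f)" "\<And>f. star c * rep a f = rep a (B' f)"
    and B: "\<And>f. norm (B f) \<le> R * norm f" "\<And>f. norm (B' f) \<le> R * norm f" and R: "0 \<le> R"
  shows "norm c \<le> R"
proof -
  let ?D = "\<lambda>f. B' (B f)"
  have pow: "(star c * c) ^ n = rep a ((?D ^^ n) vac)" for n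
    by (induction n) (simp_all add: mult.assoc c)
  have D: "norm ((?D ^^ n) vac) \<le> (R\<^sup>2) ^ n" for n
  proof (induction n)
    case (Suc n)
    have "norm (?D f) \<le> R\<^sup>2 * norm f" for f
      using order_trans[OF B(2)[of "B f"] mult_left_mono[OF B(1)[of f] R]]
      by (simp add: power2_eq_square mult.assoc)
    from order_trans[OF this mult_left_mono[OF Suc, of "R\<^sup>2"]] show ?case by simp
  qed simp
  have "norm (star c * c) \<le> R\<^sup>2"
  proof (rule norm_le_of_moments)
    show "star (star c * c) = star c * c" by (simp add: star_mult star_star)
    fix n
    have "Re (\<tau> ((star c * c) ^ (2 * n))) = vac \<bullet> (?D ^^ (2 * n)) vac"
      by (simp only: pow state_rep inner_ket Re_complex_of_real)
    also have "\<dots> \<le> norm (vac :: 'k fock) * norm ((?D ^^ (2 * n)) vac)"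
      by (rule norm_cauchy_schwarz)
    also have "\<dots> \<le> (R\<^sup>2) ^ (2 * n)" using D[of "2 * n"] by simp
    finally show "Re (\<tau> ((star c * c) ^ (2 * n))) \<le> (R\<^sup>2) ^ (2 * n)" .
  qed simp
  then show ?thesis unfolding cstar_identity using R by (rule power2_le_imp_le)
qed

end


section \<open>Matrices over C*-algebras\<close>

definition scale_matrix :: "complex \<Rightarrow> 'a::cstar_algebra^'n^'m \<Rightarrow> 'a^'n^'m" where
  "scale_matrix c A = (\<chi> i j. scaleC c (A $ i $ j))"

primrec matrix_power :: "'a::semiring_1^'n^'n \<Rightarrow> nat \<Rightarrow> 'a^'n^'n" where
  "matrix_power A 0 = mat 1"
| "matrix_power A (Suc n) = A ** matrix_power A n"

lemma matrix_power_commute: "matrix_power A n ** A = A ** matrix_power A n"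
  by (induction n) (simp_all flip: matrix_mul_assoc)

lemma scale_matrix_mult: "scale_matrix c A ** scale_matrix d B = scale_matrix (c * d) (A ** B)"
  by (simp add: vec_eq_iff scale_matrix_def matrix_matrix_mult_def scaleC_mult_left scaleC_mult_right
      scaleC_scaleC scaleC_sum_right) (simp add: mult.commute)

lemma scale_matrix_one [simp]: "scale_matrix 1 A = A"
  by (simp add: vec_eq_iff scale_matrix_def)

lemma matrix_power_scale: "matrix_power (scale_matrix c A) n = scale_matrix (c ^ n) (matrix_power A n)"
  by (induction n) (simp_all add: scale_matrix_mult)

lemma invertible_scale_matrix:
  fixes A :: "'a::cstar_algebra^'n^'n"
  assumes "invertible A" "c \<noteq> 0"
  shows "invertible (scale_matrix c A)"
proof -
  obtain B where "A ** B = mat 1" "B ** A = mat 1"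
    using assms(1) by (auto simp: invertible_def)
  then have "scale_matrix c A ** scale_matrix (1 / c) B = mat 1"
    "scale_matrix (1 / c) B ** scale_matrix c A = mat 1"
    using assms(2) by (simp_all add: scale_matrix_mult)
  then show ?thesis by (auto simp: invertible_def)
qed

text \<open>A Neumann series taken entry by entry, so that no norm on matrices over the algebra has
  to be introduced.\<close>

lemma invertible_one_minus:
  fixes A :: "'a::{real_normed_algebra_1,banach}^'n^'n"
  assumes sm: "\<And>i j. summable (\<lambda>n. matrix_power A n $ i $ j)"
  shows "invertible (mat 1 - A)"
proof -
  define W where "W = (\<chi> i j. \<Sum>n. matrix_power A n $ i $ j)"
  have head: "W $ i $ j = (\<Sum>n. matrix_power A (Suc n) $ i $ j) + mat 1 $ i $ j" for i j
    using suminf_split_head[OF sm[of i j]] by (simp add: W_def)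
  have "(A ** W) $ i $ j = (\<Sum>n. matrix_power A (Suc n) $ i $ j)" for i j
  proof -
    have "(A ** W) $ i $ j = (\<Sum>l\<in>UNIV. \<Sum>n. A $ i $ l * matrix_power A n $ l $ j)"
      by (simp add: matrix_matrix_mult_def W_def suminf_mult[OF sm])
    also have "\<dots> = (\<Sum>n. \<Sum>l\<in>UNIV. A $ i $ l * matrix_power A n $ l $ j)"
      by (rule suminf_sum[symmetric]) (rule summable_mult[OF sm])
    finally show ?thesis by (simp add: matrix_matrix_mult_def)
  qed
  then have AW: "A ** W = W - mat 1" by (simp add: vec_eq_iff head)
  have "(W ** A) $ i $ j = (\<Sum>n. matrix_power A (Suc n) $ i $ j)" for i j
  proof -
    have "(W ** A) $ i $ j = (\<Sum>l\<in>UNIV. \<Sum>n. matrix_power A n $ i $ l * A $ l $ j)"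
      by (simp add: matrix_matrix_mult_def W_def suminf_mult2[OF sm])
    also have "\<dots> = (\<Sum>n. \<Sum>l\<in>UNIV. matrix_power A n $ i $ l * A $ l $ j)"
      by (rule suminf_sum[symmetric]) (rule summable_mult2[OF sm])
    also have "\<dots> = (\<Sum>n. (matrix_power A n ** A) $ i $ j)"
      by (simp add: matrix_matrix_mult_def)
    finally show ?thesis by (simp add: matrix_power_commute)
  qed
  then have WA: "W ** A = W - mat 1" by (simp add: vec_eq_iff head)
  have "(mat 1 - A) ** W = mat 1 ** W - A ** W" "W ** (mat 1 - A) = W ** mat 1 - W ** A"
    by (simp_all add: vec_eq_iff matrix_matrix_mult_def left_diff_distrib right_diff_distrib sum_subtractf)
  then show ?thesis unfolding invertible_def by (intro exI[of _ W]) (simp add: AW WA)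
qed

lemma mstar_mult: "mstar (A ** B) = mstar B ** mstar A"
  by (simp add: vec_eq_iff mstar_def matrix_matrix_mult_def star_sum star_mult)

lemma mstar_mat_1: "mstar (mat 1) = (mat 1 :: 'a::cstar_algebra^'n^'n)"
  by (auto simp: vec_eq_iff mstar_def mat_def)

lemma mstar_matrix_power: "mstar A = A \<Longrightarrow> mstar (matrix_power A n) = matrix_power A n"
  by (induction n) (simp_all add: mstar_mat_1 mstar_mult matrix_power_commute)

text \<open>Positivity at \<open>f i - f j\<close> bounds each symmetrised pair of cross terms by
  the two diagonal terms; summing over all pairs gives the factor \<open>card J\<close>.\<close>

lemma (in cstar_prob_space) state_sum_le:
  assumes "finite J"
  shows "Re (\<tau> (star (\<Sum>j\<in>J. f j) * (\<Sum>j\<in>J. f j))) \<le> real (card J) * (\<Sum>j\<in>J. Re (\<tau> (star (f j) * f j)))"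
proof -
  define G where "G i j = Re (\<tau> (star (f i) * f j))" for i j
  have pair: "G i j + G j i \<le> G i i + G j j" for i j
    using state_nonneg[of "f i - f j"]
    by (simp add: G_def star_diff left_diff_distrib right_diff_distrib state_diff)
  have "Re (\<tau> (star (\<Sum>j\<in>J. f j) * (\<Sum>j\<in>J. f j))) = (\<Sum>i\<in>J. \<Sum>j\<in>J. G i j)"
    by (simp add: G_def star_sum sum_distrib_left sum_distrib_right state_sum) (rule sum.swap)
  moreover have "(\<Sum>i\<in>J. \<Sum>j\<in>J. G i j) = (\<Sum>i\<in>J. \<Sum>j\<in>J. G j i)" by (rule sum.swap)
  moreover have "(\<Sum>i\<in>J. \<Sum>j\<in>J. G i j + G j i) \<le> (\<Sum>i\<in>J. \<Sum>j\<in>J. G i i + G j j)"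
    by (intro sum_mono pair)
  moreover have "(\<Sum>i\<in>J. \<Sum>j\<in>J. G i i + G j j) = 2 * (real (card J) * (\<Sum>j\<in>J. G j j))"
    by (simp add: sum.distrib sum_distrib_left)
  ultimately show ?thesis by (simp add: sum.distrib G_def)
qed


section \<open>The spectrum\<close>

locale semicircular_matrix = semicircular_system \<tau> a
  for \<tau> :: "'a::cstar_algebra \<Rightarrow> complex" and a :: "'d::finite \<times> 'm::finite \<Rightarrow> 'a" +
  fixes \<sigma> :: "real^'m^'d" and b :: "real^'d"
begin

definition X :: "'a^'m^'d" where
  "X = (\<chi> i j. \<sigma> $ i $ j *\<^sub>R a (i, j))"

definition Y :: "'a^'d^'d" where
  "Y = X ** mstar X + tensor (diagonal b) 1"

definition vec_rep :: "('d \<times> 'm) fock^'n \<Rightarrow> 'a^'n" where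
  "vec_rep \<zeta> = (\<chi> i. rep a (\<zeta> $ i))"

section \<open>Intertwining of the matrices with the model\<close>

lemma X_vec_rep: "X *v vec_rep \<eta> = vec_rep (noise \<sigma> \<eta>)"
  by (simp add: vec_eq_iff matrix_vector_mult_def X_def vec_rep_def noise_def mult_rep
      linear_sum[OF linear_rep] linear_scale[OF linear_rep])

lemma mstar_X_vec_rep: "mstar X *v vec_rep \<zeta> = vec_rep (noise_adj \<sigma> \<zeta>)"
  by (simp add: vec_eq_iff matrix_vector_mult_def X_def mstar_def vec_rep_def noise_adj_def mult_rep
      star_scaleR linear_sum[OF linear_rep] linear_scale[OF linear_rep])

lemma tensor_diagonal_vec_rep:
  "tensor (diagonal b) 1 *v vec_rep \<zeta> = vec_rep (\<chi> i. b $ i *\<^sub>R \<zeta> $ i)"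
proof -
  have "(\<Sum>j\<in>UNIV. scaleC (if i = j then complex_of_real (b $ i) else 0) 1 * rep a (\<zeta> $ j)) =
      (\<Sum>j\<in>UNIV. if i = j then b $ i *\<^sub>R rep a (\<zeta> $ i) else 0)" for i
    by (rule sum.cong) (auto simp: scaleC_of_real)
  then show ?thesis
    by (simp add: vec_eq_iff matrix_vector_mult_def tensor_def diagonal_def vec_rep_def
        linear_scale[OF linear_rep])
qed

lemma vec_rep_add: "vec_rep (\<zeta> + \<theta>) = vec_rep \<zeta> + vec_rep \<theta>"
  by (simp add: vec_eq_iff vec_rep_def linear_add[OF linear_rep])

lemma Y_vec_rep: "Y *v vec_rep \<zeta> = vec_rep (model \<sigma> b \<zeta>)"
  unfolding Y_def model_def vec_rep_add
  by (simp add: matrix_vector_mult_add_rdistrib X_vec_rep mstar_X_vec_rep tensor_diagonal_vec_rep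
      flip: matrix_vector_mul_assoc)

lemma Y_minus_vec_rep:
  "(Y - mat (scaleC (complex_of_real t) 1)) *v vec_rep \<zeta> = vec_rep (model \<sigma> b \<zeta> - t *\<^sub>R \<zeta>)"
proof -
  have "(\<Sum>j\<in>UNIV. (if i = j then scaleC (complex_of_real t) 1 else 0) * rep a (\<zeta> $ j)) =
      (\<Sum>j\<in>UNIV. if i = j then t *\<^sub>R rep a (\<zeta> $ i) else 0)" for i
    by (rule sum.cong) (auto simp: scaleC_of_real)
  then have "mat (scaleC (complex_of_real t) 1) *v vec_rep \<zeta> = t *\<^sub>R vec_rep \<zeta>"
    by (simp add: vec_eq_iff matrix_vector_mult_def mat_def vec_rep_def)
  moreover have "(Y - mat (scaleC (complex_of_real t) 1)) *v vec_rep \<zeta>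
      = Y *v vec_rep \<zeta> - mat (scaleC (complex_of_real t) 1) *v vec_rep \<zeta>"
    by (simp add: vec_eq_iff matrix_vector_mult_def left_diff_distrib sum_subtractf)
  ultimately show ?thesis
    unfolding Y_vec_rep
    by (simp add: vec_eq_iff vec_rep_def linear_diff[OF linear_rep] linear_scale[OF linear_rep])
qed

lemma mstar_Y_minus:
  "mstar (Y - mat (scaleC (complex_of_real t) 1)) = Y - mat (scaleC (complex_of_real t) 1)"
proof -
  have "mstar (X ** mstar X) = X ** mstar X"
    unfolding mstar_mult by (simp add: mstar_def star_star)
  then have "star ((X ** mstar X) $ j $ i) = (X ** mstar X) $ i $ j" for i j
    by (simp add: vec_eq_iff mstar_def)
  then show ?thesis
    by (simp add: vec_eq_iff Y_def) (simp add: mstar_def star_add star_diff tensor_def diagonal_def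
      mat_def scaleC_of_real star_scaleR)
qed

text \<open>Each entry of a power, composed with \<open>rep a\<close>, is a block of the same power
  on the Fock space. The power is self-adjoint, so the star of an entry is the transposed entry and
  obeys the same bound, as \<open>norm_le_of_rep\<close> demands.\<close>

lemma norm_matrix_power_le:
  fixes t :: real
  defines "M \<equiv> Y - mat (scaleC (complex_of_real t) 1)"
  assumes N: "\<And>\<zeta>. norm (model \<sigma> b \<zeta> - t *\<^sub>R \<zeta>) \<le> r * norm \<zeta>" and r: "0 \<le> r"
  shows "norm (matrix_power M n $ i $ j) \<le> r ^ n"
proof -
  let ?N = "\<lambda>\<zeta>. model \<sigma> b \<zeta> - t *\<^sub>R \<zeta>"
  have pow: "matrix_power M n *v vec_rep \<zeta> = vec_rep ((?N ^^ n) \<zeta>)" for \<zeta>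
    by (induction n) (simp_all add: Y_minus_vec_rep M_def flip: matrix_vector_mul_assoc)
  have norm_pow: "norm ((?N ^^ n) \<zeta>) \<le> r ^ n * norm \<zeta>" for \<zeta>
  proof (induction n)
    case (Suc n)
    from order_trans[OF N mult_left_mono[OF this r]] show ?case by (simp add: mult.assoc)
  qed simp
  have entry: "matrix_power M n $ i $ j * rep a f = rep a ((?N ^^ n) (axis j f) $ i)" for i j f
  proof -
    have "(matrix_power M n *v vec_rep (axis j f)) $ i =
        (\<Sum>l\<in>UNIV. if l = j then matrix_power M n $ i $ j * rep a f else 0)"
      unfolding matrix_vector_mult_def vec_lambda_beta
      by (rule sum.cong) (auto simp: vec_rep_def axis_def linear_0[OF linear_rep])
    then show ?thesis unfolding pow by (simp add: vec_rep_def)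
  qed
  have entry_norm: "norm ((?N ^^ n) (axis j f) $ i) \<le> r ^ n * norm f" for i j f
  proof -
    have "norm (axis j f :: ('d \<times> 'm) fock^'d) = norm f"
      by (simp add: norm_eq_sqrt_inner inner_axis_axis)
    then show ?thesis
      using order_trans[OF Finite_Cartesian_Product.norm_nth_le norm_pow, of "axis j f"] by simp
  qed
  have "mstar (matrix_power M n) = matrix_power M n"
    unfolding M_def by (intro mstar_matrix_power mstar_Y_minus)
  then have "star (matrix_power M n $ i $ j) = matrix_power M n $ j $ i"
    by (metis (lifting) mstar_def vec_lambda_beta)
  then show ?thesis
    using entry entry_norm r by (intro norm_le_of_rep) simp_all
qed

text \<open>The entries of the powers of \<open>M\<close> grow at most like \<open>r ^ n\<close>, so
  the Neumann series in \<open>1 / c\<close> converges outside the disc of radius \<open>r\<close>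
  about the real point \<open>t\<close>.\<close>

lemma invertible_Y_minus:
  assumes N: "\<And>\<zeta>. norm (model \<sigma> b \<zeta> - t *\<^sub>R \<zeta>) \<le> r * norm \<zeta>" and r: "0 \<le> r"
    and z: "r < cmod (z - complex_of_real t)"
  shows "invertible (Y - mat (scaleC z 1))"
proof -
  define c where "c = z - complex_of_real t"
  have c: "r < cmod c" "c \<noteq> 0" using z r by (auto simp: c_def)
  define M where "M = Y - mat (scaleC (complex_of_real t) 1)"
  have "summable (\<lambda>n. matrix_power (scale_matrix (1 / c) M) n $ i $ j)" for i j
  proof (rule summable_comparison_test'[where N = 0])
    show "summable (\<lambda>n. (r / cmod c) ^ n)"
      using c r by (intro summable_geometric) simp
    show "norm (matrix_power (scale_matrix (1 / c) M) n $ i $ j) \<le> (r / cmod c) ^ n" for n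
      using norm_matrix_power_le[OF N r, of n i j] c unfolding matrix_power_scale
      by (simp add: scale_matrix_def norm_scaleC norm_power norm_divide power_divide
          divide_right_mono flip: M_def)
  qed
  then have "invertible (scale_matrix (- c) (mat 1 - scale_matrix (1 / c) M))"
    using c by (intro invertible_scale_matrix invertible_one_minus) simp_all
  also have "scale_matrix (- c) (mat 1 - scale_matrix (1 / c) M) = Y - mat (scaleC z 1)"
    using c(2)
    by (simp add: vec_eq_iff scale_matrix_def M_def mat_def scaleC_diff_right scaleC_scaleC
        scaleC_minus_left) (simp add: c_def scaleC_diff_left)
  finally show ?thesis .
qed

text \<open>The entries of the inverse \<open>W\<close> may lie outside the image of
  \<open>rep\<close>, so they are estimated in L2 of the trace, where multiplication by each is
  bounded by its norm and \<open>rep\<close> is isometric. The constant collects these entrywise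
  estimates.\<close>

lemma bounded_below_of_invertible:
  assumes "invertible (Y - mat (scaleC (complex_of_real t) 1))"
  obtains C where "0 \<le> C" "\<And>\<zeta>. (norm \<zeta>)\<^sup>2 \<le> C * (norm (model \<sigma> b \<zeta> - t *\<^sub>R \<zeta>))\<^sup>2"
proof -
  obtain W where W: "W ** (Y - mat (scaleC (complex_of_real t) 1)) = mat 1"
    using assms by (auto simp: invertible_def)
  define C where "C = real CARD('d) * (\<Sum>i\<in>UNIV. \<Sum>j\<in>UNIV. (norm (W $ i $ j))\<^sup>2)"
  have nrm: "(norm f)\<^sup>2 = Re (\<tau> (star (rep a f) * rep a f))" for f
    by (simp add: state_rep_rep power2_norm_eq_inner)
  have sq: "(norm \<zeta>)\<^sup>2 = (\<Sum>i\<in>UNIV. (norm (\<zeta> $ i))\<^sup>2)" for \<zeta> :: "('d \<times> 'm) fock^'d"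
    by (simp add: power2_norm_eq_inner inner_vec_def)
  show thesis
  proof
    show "0 \<le> C" unfolding C_def by (intro mult_nonneg_nonneg sum_nonneg) auto
    fix \<zeta>
    let ?\<theta> = "model \<sigma> b \<zeta> - t *\<^sub>R \<zeta>"
    have "vec_rep \<zeta> = W *v vec_rep ?\<theta>"
      unfolding Y_minus_vec_rep[symmetric] by (simp add: matrix_vector_mul_assoc W)
    then have rep: "rep a (\<zeta> $ i) = (\<Sum>j\<in>UNIV. W $ i $ j * rep a (?\<theta> $ j))" for i
      by (simp add: vec_eq_iff vec_rep_def matrix_vector_mult_def)
    have "(norm (\<zeta> $ i))\<^sup>2 \<le> real CARD('d) * (\<Sum>j\<in>UNIV. (norm (W $ i $ j))\<^sup>2) * (norm ?\<theta>)\<^sup>2" for i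
    proof -
      have "(norm (\<zeta> $ i))\<^sup>2 \<le> real CARD('d) * (\<Sum>j\<in>UNIV. Re (\<tau> (star (W $ i $ j * rep a (?\<theta> $ j)) *
          (W $ i $ j * rep a (?\<theta> $ j)))))"
        unfolding nrm rep by (rule state_sum_le) simp
      also have "\<dots> \<le> real CARD('d) * (\<Sum>j\<in>UNIV. (norm (W $ i $ j))\<^sup>2 * (norm ?\<theta>)\<^sup>2)"
      proof (intro mult_left_mono sum_mono)
        fix j
        have "Re (\<tau> (star (W $ i $ j * rep a (?\<theta> $ j)) * (W $ i $ j * rep a (?\<theta> $ j))))
            \<le> (norm (W $ i $ j))\<^sup>2 * (norm (?\<theta> $ j))\<^sup>2"
          unfolding nrm by (rule state_mult_le)
        also have "\<dots> \<le> (norm (W $ i $ j))\<^sup>2 * (norm ?\<theta>)\<^sup>2"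
          by (rule mult_left_mono[OF power_mono[OF Finite_Cartesian_Product.norm_nth_le]]) simp_all
        finally show "Re (\<tau> (star (W $ i $ j * rep a (?\<theta> $ j)) * (W $ i $ j * rep a (?\<theta> $ j))))
            \<le> (norm (W $ i $ j))\<^sup>2 * (norm ?\<theta>)\<^sup>2" .
      qed simp
      finally show ?thesis by (simp add: sum_distrib_right mult.assoc)
    qed
    then have "(norm \<zeta>)\<^sup>2 \<le> (\<Sum>i\<in>UNIV. real CARD('d) * (\<Sum>j\<in>UNIV. (norm (W $ i $ j))\<^sup>2) * (norm ?\<theta>)\<^sup>2)"
      unfolding sq[of \<zeta>] by (intro sum_mono)
    also have "\<dots> = C * (norm ?\<theta>)\<^sup>2"
      unfolding C_def by (simp only: sum_distrib_left sum_distrib_right)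
    finally show "(norm \<zeta>)\<^sup>2 \<le> C * (norm ?\<theta>)\<^sup>2" .
  qed
qed

section \<open>The spectrum between optimal form bounds\<close>

context
  fixes \<alpha> \<beta> :: real
  assumes lo: "\<And>\<zeta>. \<beta> * (\<zeta> \<bullet> \<zeta>) \<le> model \<sigma> b \<zeta> \<bullet> \<zeta>"
    and hi: "\<And>\<zeta>. model \<sigma> b \<zeta> \<bullet> \<zeta> \<le> \<alpha> * (\<zeta> \<bullet> \<zeta>)"
begin

lemma bounds_ordered: "\<beta> \<le> \<alpha>"
  using order_trans[OF lo hi, of "site undefined"] by (simp add: inner_site_site)

lemma model_minus_lower:
  shows "(norm (model \<sigma> b \<zeta> - \<beta> *\<^sub>R \<zeta>))\<^sup>2 \<le> (\<alpha> - \<beta>) * (model \<sigma> b \<zeta> \<bullet> \<zeta> - \<beta> * (\<zeta> \<bullet> \<zeta>))"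
    and "norm (model \<sigma> b \<zeta> - \<beta> *\<^sub>R \<zeta>) \<le> (\<alpha> - \<beta>) * norm \<zeta>"
proof -
  let ?A = "\<lambda>\<zeta>. model \<sigma> b \<zeta> - \<beta> *\<^sub>R \<zeta>"
  have lin: "linear ?A" by (intro linear_compose_sub linear_model linear_scale_self)
  have sym: "?A x \<bullet> y = x \<bullet> ?A y" for x y
    by (simp add: inner_diff_left inner_diff_right inner_model)
  have pos: "0 \<le> ?A x \<bullet> x" and le: "?A x \<bullet> x \<le> (\<alpha> - \<beta>) * (x \<bullet> x)" for x
    using lo[of x] hi[of x] by (simp_all add: inner_diff_left left_diff_distrib)
  show "(norm (?A \<zeta>))\<^sup>2 \<le> (\<alpha> - \<beta>) * (model \<sigma> b \<zeta> \<bullet> \<zeta> - \<beta> * (\<zeta> \<bullet> \<zeta>))"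
    using norm_le_of_form_bounds(1)[OF lin sym pos le, of \<zeta>] bounds_ordered
    by (simp add: inner_diff_left)
  show "norm (?A \<zeta>) \<le> (\<alpha> - \<beta>) * norm \<zeta>"
    using norm_le_of_form_bounds(2)[OF lin sym pos le, of \<zeta>] bounds_ordered by simp
qed

lemma model_minus_upper:
  shows "(norm (model \<sigma> b \<zeta> - \<alpha> *\<^sub>R \<zeta>))\<^sup>2 \<le> (\<alpha> - \<beta>) * (\<alpha> * (\<zeta> \<bullet> \<zeta>) - model \<sigma> b \<zeta> \<bullet> \<zeta>)"
    and "norm (model \<sigma> b \<zeta> - \<alpha> *\<^sub>R \<zeta>) \<le> (\<alpha> - \<beta>) * norm \<zeta>"
proof -
  let ?A = "\<lambda>\<zeta>. \<alpha> *\<^sub>R \<zeta> - model \<sigma> b \<zeta>"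
  have lin: "linear ?A" by (intro linear_compose_sub linear_model linear_scale_self)
  have sym: "?A x \<bullet> y = x \<bullet> ?A y" for x y
    by (simp add: inner_diff_left inner_diff_right inner_model)
  have pos: "0 \<le> ?A x \<bullet> x" and le: "?A x \<bullet> x \<le> (\<alpha> - \<beta>) * (x \<bullet> x)" for x
    using lo[of x] hi[of x] by (simp_all add: inner_diff_left left_diff_distrib)
  show "(norm (model \<sigma> b \<zeta> - \<alpha> *\<^sub>R \<zeta>))\<^sup>2 \<le> (\<alpha> - \<beta>) * (\<alpha> * (\<zeta> \<bullet> \<zeta>) - model \<sigma> b \<zeta> \<bullet> \<zeta>)"
    using norm_le_of_form_bounds(1)[OF lin sym pos le, of \<zeta>] bounds_ordered
    by (simp add: inner_diff_left norm_minus_commute)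
  show "norm (model \<sigma> b \<zeta> - \<alpha> *\<^sub>R \<zeta>) \<le> (\<alpha> - \<beta>) * norm \<zeta>"
    using norm_le_of_form_bounds(2)[OF lin sym pos le, of \<zeta>] bounds_ordered
    by (simp add: norm_minus_commute)
qed

text \<open>The spectrum lies in the discs of radius \<open>\<alpha> - \<beta>\<close> about
  \<alpha> and about \<beta>; the first bounds the real part from below by \<beta>, the second from
  above by \<alpha>.\<close>

lemma spectrum_bounds:
  assumes "z \<in> matrix_spectrum Y"
  shows "\<beta> \<le> Re z" "Re z \<le> \<alpha>"
proof -
  have far: "\<not> \<alpha> - \<beta> < cmod (z - complex_of_real \<alpha>)" "\<not> \<alpha> - \<beta> < cmod (z - complex_of_real \<beta>)"
    using assms bounds_ordered invertible_Y_minus[OF model_minus_upper(2)]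
      invertible_Y_minus[OF model_minus_lower(2)]
    by (auto simp: matrix_spectrum_def)
  then show "\<beta> \<le> Re z" "Re z \<le> \<alpha>"
    using abs_Re_le_cmod[of "z - complex_of_real \<alpha>"] abs_Re_le_cmod[of "z - complex_of_real \<beta>"]
    by auto
qed

text \<open>Were \<open>Y - \<alpha>\<close> invertible, \<open>\<alpha> - model\<close> would be bounded below and \<open>\<alpha>\<close> could be decreased.\<close>

lemma upper_in_spectrum:
  assumes min: "\<And>c. (\<And>\<zeta>. model \<sigma> b \<zeta> \<bullet> \<zeta> \<le> c * (\<zeta> \<bullet> \<zeta>)) \<Longrightarrow> \<alpha> \<le> c"
  shows "complex_of_real \<alpha> \<in> matrix_spectrum Y"
proof (rule ccontr)
  assume "complex_of_real \<alpha> \<notin> matrix_spectrum Y"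
  then have "invertible (Y - mat (scaleC (complex_of_real \<alpha>) 1))" by (simp add: matrix_spectrum_def)
  then obtain C where C: "0 \<le> C" "\<And>\<zeta>. (norm \<zeta>)\<^sup>2 \<le> C * (norm (model \<sigma> b \<zeta> - \<alpha> *\<^sub>R \<zeta>))\<^sup>2"
    using bounded_below_of_invertible by blast
  \<comment> \<open>The summand 1 makes \<open>D\<close> positive also when \<open>C\<close> or
    \<open>\<alpha> - \<beta>\<close> vanishes.\<close>
  define D where "D = C * (\<alpha> - \<beta>) + 1"
  have D: "0 < D" using C(1) bounds_ordered by (simp add: D_def add_nonneg_pos)
  have "model \<sigma> b \<zeta> \<bullet> \<zeta> \<le> (\<alpha> - 1 / D) * (\<zeta> \<bullet> \<zeta>)" for \<zeta>
  proof -
    let ?q = "\<alpha> * (\<zeta> \<bullet> \<zeta>) - model \<sigma> b \<zeta> \<bullet> \<zeta>"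
    have "\<zeta> \<bullet> \<zeta> \<le> C * ((\<alpha> - \<beta>) * ?q)"
      using order_trans[OF C(2) mult_left_mono[OF model_minus_upper(1) C(1)]]
      by (simp add: power2_norm_eq_inner)
    also have "\<dots> \<le> D * ?q" using hi[of \<zeta>] by (simp add: D_def distrib_right mult.assoc)
    finally have "(\<zeta> \<bullet> \<zeta>) / D \<le> ?q" using D by (simp add: divide_le_eq mult.commute)
    then show ?thesis by (simp add: left_diff_distrib)
  qed
  then have "\<alpha> \<le> \<alpha> - 1 / D" by (rule min)
  then show False using D by simp
qed

text \<open>Mirror image of \<open>upper_in_spectrum\<close>: an inverse at \<beta> would allow
  \<beta> to be increased.\<close>

lemma lower_in_spectrum:
  assumes max: "\<And>c. (\<And>\<zeta>. c * (\<zeta> \<bullet> \<zeta>) \<le> model \<sigma> b \<zeta> \<bullet> \<zeta>) \<Longrightarrow> c \<le> \<beta>"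
  shows "complex_of_real \<beta> \<in> matrix_spectrum Y"
proof (rule ccontr)
  assume "complex_of_real \<beta> \<notin> matrix_spectrum Y"
  then have "invertible (Y - mat (scaleC (complex_of_real \<beta>) 1))" by (simp add: matrix_spectrum_def)
  then obtain C where C: "0 \<le> C" "\<And>\<zeta>. (norm \<zeta>)\<^sup>2 \<le> C * (norm (model \<sigma> b \<zeta> - \<beta> *\<^sub>R \<zeta>))\<^sup>2"
    using bounded_below_of_invertible by blast
  define D where "D = C * (\<alpha> - \<beta>) + 1"
  have D: "0 < D" using C(1) bounds_ordered by (simp add: D_def add_nonneg_pos)
  have "(\<beta> + 1 / D) * (\<zeta> \<bullet> \<zeta>) \<le> model \<sigma> b \<zeta> \<bullet> \<zeta>" for \<zeta>
  proof -
    let ?q = "model \<sigma> b \<zeta> \<bullet> \<zeta> - \<beta> * (\<zeta> \<bullet> \<zeta>)"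
    have "\<zeta> \<bullet> \<zeta> \<le> C * ((\<alpha> - \<beta>) * ?q)"
      using order_trans[OF C(2) mult_left_mono[OF model_minus_lower(1) C(1)]]
      by (simp add: power2_norm_eq_inner)
    also have "\<dots> \<le> D * ?q" using lo[of \<zeta>] by (simp add: D_def distrib_right mult.assoc)
    finally have "(\<zeta> \<bullet> \<zeta>) / D \<le> ?q" using D by (simp add: divide_le_eq mult.commute)
    then show ?thesis by (simp add: distrib_right)
  qed
  then have "\<beta> + 1 / D \<le> \<beta>" by (rule max)
  then show False using D by simp
qed

end

lemma lambda_eq_form_bounds:
  assumes lo: "\<And>\<zeta>. \<beta> * (\<zeta> \<bullet> \<zeta>) \<le> model \<sigma> b \<zeta> \<bullet> \<zeta>"
    and hi: "\<And>\<zeta>. model \<sigma> b \<zeta> \<bullet> \<zeta> \<le> \<alpha> * (\<zeta> \<bullet> \<zeta>)"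
    and max: "\<And>c. (\<And>\<zeta>. c * (\<zeta> \<bullet> \<zeta>) \<le> model \<sigma> b \<zeta> \<bullet> \<zeta>) \<Longrightarrow> c \<le> \<beta>"
    and min: "\<And>c. (\<And>\<zeta>. model \<sigma> b \<zeta> \<bullet> \<zeta> \<le> c * (\<zeta> \<bullet> \<zeta>)) \<Longrightarrow> \<alpha> \<le> c"
  shows "lambda_max Y = \<alpha>" "lambda_min Y = \<beta>"
proof -
  have "\<alpha> \<in> Re ` matrix_spectrum Y" "\<beta> \<in> Re ` matrix_spectrum Y"
    using upper_in_spectrum[OF lo hi min] lower_in_spectrum[OF lo hi max] by force+
  then show "lambda_max Y = \<alpha>" "lambda_min Y = \<beta>"
    unfolding lambda_max_def lambda_min_def
    using spectrum_bounds[OF lo hi] by (auto intro!: cSup_eq_maximum cInf_eq_minimum)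
qed

end


section \<open>The variational formulas\<close>

text \<open>The infimum of all admissible constants is itself admissible, because each quotient of
  the form lies below all of them; the quotient at \<open>x0\<close> keeps the infimum
  finite.\<close>

lemma best_upper_bound:
  fixes A :: "'v::real_inner \<Rightarrow> 'v" and x0 :: 'v
  assumes "linear A" "x0 \<noteq> 0" and c: "\<And>x. A x \<bullet> x \<le> c * (x \<bullet> x)"
  obtains \<alpha> where "\<And>x. A x \<bullet> x \<le> \<alpha> * (x \<bullet> x)"
    "\<And>c. (\<And>x. A x \<bullet> x \<le> c * (x \<bullet> x)) \<Longrightarrow> \<alpha> \<le> c"
proof -
  define S where "S = {c. \<forall>x. A x \<bullet> x \<le> c * (x \<bullet> x)}"
  have lower: "A x \<bullet> x / (x \<bullet> x) \<le> c" if "c \<in> S" "x \<noteq> 0" for c x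
    using that by (simp add: S_def divide_le_eq)
  have ne: "S \<noteq> {}" using c by (auto simp: S_def)
  have bdd: "bdd_below S" by (rule bdd_belowI[OF lower[OF _ assms(2)]])
  show thesis
  proof
    show "A x \<bullet> x \<le> Inf S * (x \<bullet> x)" for x
    proof (cases "x = 0")
      case False
      then have "A x \<bullet> x / (x \<bullet> x) \<le> Inf S" by (intro cInf_greatest ne lower)
      then show ?thesis using False by (simp add: divide_le_eq)
    qed (simp add: linear_0[OF assms(1)])
    show "Inf S \<le> c" if "\<And>x. A x \<bullet> x \<le> c * (x \<bullet> x)" for c
      by (rule cInf_lower[OF _ bdd]) (use that in \<open>simp add: S_def\<close>)
  qed
qed

lemma feasible_max_iff:
  "v \<in> feasible_max \<sigma> \<longleftrightarrow> (\<forall>i. 0 < v $ i) \<and> (\<forall>j. (\<Sum>k\<in>UNIV. (\<sigma> $ k $ j)\<^sup>2 * v $ k) < 1)"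
  by (simp add: feasible_max_def)

lemma feasible_min_iff: "v \<in> feasible_min \<longleftrightarrow> (\<forall>i. v $ i < 0)"
  by (simp add: feasible_min_def)

lemma feasible_max_nonempty:
  fixes \<sigma> :: "real^'m^'d"
  shows "feasible_max \<sigma> \<noteq> {}"
proof -
  \<comment> \<open>The total dominates every column sum, so the constant vector with entries
    \<open>1 / (1 + T)\<close> satisfies all column constraints strictly.\<close>
  define T where "T = (\<Sum>j\<in>UNIV. \<Sum>k\<in>UNIV. (\<sigma> $ k $ j)\<^sup>2)"
  have T: "0 \<le> T" unfolding T_def by (intro sum_nonneg) simp
  have le: "(\<Sum>k\<in>UNIV. (\<sigma> $ k $ j)\<^sup>2) \<le> T" for j
    unfolding T_def by (rule member_le_sum) (auto intro: sum_nonneg)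
  have "(\<Sum>k\<in>UNIV. (\<sigma> $ k $ j)\<^sup>2 * (1 / (1 + T))) < 1" for j
  proof -
    have "(\<Sum>k\<in>UNIV. (\<sigma> $ k $ j)\<^sup>2 * (1 / (1 + T))) = (\<Sum>k\<in>UNIV. (\<sigma> $ k $ j)\<^sup>2) / (1 + T)"
      by (simp add: sum_divide_distrib)
    also have "\<dots> < 1" using le[of j] T by simp
    finally show ?thesis .
  qed
  then have "(\<chi> i. 1 / (1 + T)) \<in> feasible_max \<sigma>"
    using T by (simp add: feasible_max_iff)
  then show ?thesis by blast
qed

theorem corollary1p5:
  fixes \<tau> :: "'a::cstar_algebra \<Rightarrow> complex"
    and \<sigma> :: "real^'m^'d"
    and s :: "'d \<Rightarrow> 'm \<Rightarrow> 'a"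
    and x :: "'a^'m^'d"
    and b :: "real^'d"
  assumes "faithful_trace_cstar_prob_space \<tau>"
    and "\<forall>i j. \<sigma> $ i $ j \<ge> 0"
    and "free_semicircular_family \<tau> (\<lambda>(i, j). s i j)"
    and "x = (\<Sum>i\<in>UNIV. \<Sum>j\<in>UNIV.
               tensor (\<sigma> $ i $ j *\<^sub>R outer (axis i 1) (axis j 1)) (s i j))"
  shows "(ereal (lambda_max (x ** mstar x + tensor (diagonal b) 1)) =
           (INF v \<in> feasible_max \<sigma>. ereal (MAX i. objective \<sigma> b v $ i))) \<and>
         (ereal (lambda_min (x ** mstar x + tensor (diagonal b) 1)) =
           (SUP v \<in> feasible_min. ereal (MIN i. objective \<sigma> b v $ i))) \<and>
         ((INF v \<in> feasible_max \<sigma> \<inter> equalizing \<sigma> b. ereal (MAX i. objective \<sigma> b v $ i)) =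
           (INF v \<in> feasible_max \<sigma>. ereal (MAX i. objective \<sigma> b v $ i))) \<and>
         ((SUP v \<in> feasible_min \<inter> equalizing \<sigma> b. ereal (MIN i. objective \<sigma> b v $ i)) =
           (SUP v \<in> feasible_min. ereal (MIN i. objective \<sigma> b v $ i)))"
proof -
  interpret faithful_trace_cstar_prob_space \<tau> by (rule assms(1))
  interpret semicircular_matrix \<tau> "\<lambda>(i, j). s i j" \<sigma> b
    by unfold_locales (rule assms(3))
  have "x = X"
  proof -
    have "x $ k $ l = \<sigma> $ k $ l *\<^sub>R s k l" for k l
    proof -
      have "x $ k $ l = (\<Sum>i\<in>UNIV. \<Sum>j\<in>UNIV. if j = l then if i = k then \<sigma> $ k $ l *\<^sub>R s k l else 0 else 0)"
        unfolding assms(4) sum_component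
        by (intro sum.cong) (auto simp: tensor_def outer_def axis_def scaleC_of_real
            scaleR_conv_of_real[of _ "1 :: complex"])
      then show ?thesis by simp
    qed
    then show ?thesis by (simp add: vec_eq_iff X_def)
  qed
  then have Y: "x ** mstar x + tensor (diagonal b) 1 = Y" by (simp add: Y_def)
  have form_le: "model \<sigma> b \<zeta> \<bullet> \<zeta> \<le> (MAX i. objective \<sigma> b v $ i) * (\<zeta> \<bullet> \<zeta>)"
    if "v \<in> feasible_max \<sigma>" for v \<zeta>
    using that by (intro inner_model_le) (auto simp: feasible_max_iff)
  have form_ge: "(MIN i. objective \<sigma> b v $ i) * (\<zeta> \<bullet> \<zeta>) \<le> model \<sigma> b \<zeta> \<bullet> \<zeta>"
    if "v \<in> feasible_min" for v \<zeta>
    using that by (intro inner_model_ge) (auto simp: feasible_min_iff)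
  have ne: "site undefined \<noteq> (0 :: ('d \<times> 'm) fock^'d)"
    by (metis inner_site_site inner_zero_left zero_neq_one)
  obtain v0 where "v0 \<in> feasible_max \<sigma>" using feasible_max_nonempty by blast
  from best_upper_bound[OF linear_model ne form_le[OF this]] obtain \<alpha> where
    hi: "\<And>\<zeta>. model \<sigma> b \<zeta> \<bullet> \<zeta> \<le> \<alpha> * (\<zeta> \<bullet> \<zeta>)" and
    min: "\<And>c. (\<And>\<zeta>. model \<sigma> b \<zeta> \<bullet> \<zeta> \<le> c * (\<zeta> \<bullet> \<zeta>)) \<Longrightarrow> \<alpha> \<le> c"
    by blast
  have "(\<chi> i. - 1) \<in> feasible_min" by (simp add: feasible_min_iff)
  from form_ge[OF this] have "- model \<sigma> b \<zeta> \<bullet> \<zeta> \<le> - (MIN i. objective \<sigma> b (\<chi> i. - 1) $ i) * (\<zeta> \<bullet> \<zeta>)"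
    for \<zeta> by (simp only: inner_minus_left mult_minus_left neg_le_iff_le)
  \<comment> \<open>The best lower bound is minus the best upper bound of the negated form; the
    constant vector -1 supplies the initial bound.\<close>
  from best_upper_bound[OF linear_compose_neg[OF linear_model] ne this] obtain \<beta>' where
    lo': "\<And>\<zeta>. - model \<sigma> b \<zeta> \<bullet> \<zeta> \<le> \<beta>' * (\<zeta> \<bullet> \<zeta>)" and
    max': "\<And>c. (\<And>\<zeta>. - model \<sigma> b \<zeta> \<bullet> \<zeta> \<le> c * (\<zeta> \<bullet> \<zeta>)) \<Longrightarrow> \<beta>' \<le> c"
    by blast
  define \<beta> where "\<beta> = - \<beta>'"
  have lo: "\<beta> * (\<zeta> \<bullet> \<zeta>) \<le> model \<sigma> b \<zeta> \<bullet> \<zeta>" for \<zeta>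
    using lo'[of \<zeta>] by (simp add: \<beta>_def)
  have max: "c \<le> \<beta>" if "\<And>\<zeta>. c * (\<zeta> \<bullet> \<zeta>) \<le> model \<sigma> b \<zeta> \<bullet> \<zeta>" for c
    using max'[of "- c"] that by (simp add: \<beta>_def)
  let ?max = "\<lambda>v. ereal (MAX i. objective \<sigma> b v $ i)" and ?min = "\<lambda>v. ereal (MIN i. objective \<sigma> b v $ i)"
  have le1: "ereal \<alpha> \<le> (INF v\<in>feasible_max \<sigma>. ?max v)"
    by (intro INF_greatest) (simp add: min[OF form_le])
  have le2: "(SUP v\<in>feasible_min. ?min v) \<le> ereal \<beta>"
    by (intro SUP_least) (simp add: max[OF form_ge])
  \<comment> \<open>\<open>equalizing_above\<close> needs a point strictly above \<alpha>, so the
    value \<alpha> is only approached, at the points \<open>\<alpha> + e\<close>.\<close>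
  have le3: "(INF v\<in>feasible_max \<sigma> \<inter> equalizing \<sigma> b. ?max v) \<le> ereal \<alpha>"
  proof (rule ereal_le_epsilon2)
    fix e :: real assume "0 < e"
    with equalizing_above[OF lo hi, of "\<alpha> + e"] obtain v where
      v: "v \<in> feasible_max \<sigma>" "objective \<sigma> b v = (\<alpha> + e) *\<^sub>R 1" by auto
    then have "v \<in> feasible_max \<sigma> \<inter> equalizing \<sigma> b" by (auto simp: equalizing_def)
    then show "(INF v\<in>feasible_max \<sigma> \<inter> equalizing \<sigma> b. ?max v) \<le> ereal \<alpha> + ereal e"
      by (rule INF_lower2) (simp add: v(2))
  qed
  have le4: "ereal \<beta> \<le> (SUP v\<in>feasible_min \<inter> equalizing \<sigma> b. ?min v)"
  proof (rule ereal_le_epsilon2)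
    fix e :: real assume "0 < e"
    with equalizing_below[OF lo hi, of "\<beta> - e"] obtain v where
      v: "v \<in> feasible_min" "objective \<sigma> b v = (\<beta> - e) *\<^sub>R 1" by auto
    then have "v \<in> feasible_min \<inter> equalizing \<sigma> b" by (auto simp: equalizing_def)
    then have "ereal (\<beta> - e) \<le> (SUP v\<in>feasible_min \<inter> equalizing \<sigma> b. ?min v)"
      by (rule SUP_upper2) (simp add: v(2))
    then have "ereal (\<beta> - e) + ereal e \<le> (SUP v\<in>feasible_min \<inter> equalizing \<sigma> b. ?min v) + ereal e"
      by (rule add_right_mono)
    then show "ereal \<beta> \<le> (SUP v\<in>feasible_min \<inter> equalizing \<sigma> b. ?min v) + ereal e" by simp
  qed
  have le5: "(INF v\<in>feasible_max \<sigma>. ?max v) \<le> (INF v\<in>feasible_max \<sigma> \<inter> equalizing \<sigma> b. ?max v)"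
    by (rule INF_superset_mono) auto
  have le6: "(SUP v\<in>feasible_min \<inter> equalizing \<sigma> b. ?min v) \<le> (SUP v\<in>feasible_min. ?min v)"
    by (rule SUP_subset_mono) auto
  have eqs: "lambda_max Y = \<alpha>" "lambda_min Y = \<beta>"
    using lambda_eq_form_bounds[OF lo hi] max min by blast+
  show ?thesis
    unfolding Y eqs
    \<comment> \<open>Each side is one cycle: \<alpha> \<le> infimum \<le> restricted infimum \<le>
      \<alpha>, and \<beta> \<le> restricted supremum \<le> supremum \<le> \<beta>.\<close>
    using order_trans[OF le5 le3] order_trans[OF le4 le6] order_trans[OF le3 le1] order_trans[OF le2 le4]
      le1 le2 le5 le6
    by (intro conjI antisym)
qed

end
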